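(* Let $\mu \in D(A^\infty)$ and let $k \geq 1$ be an integer. For $y \in D(A^\infty)$, set $f_0(y) = y'' - y y'$ and $f_1(y) = \mu$. For $n \geq 0$, set $M_n = \mathrm{ad}_{f_0}^{n}(f_1)$, and for $N \geq 1$, set $W_N = \left[M_{N-1}, M_N\right]$. Then, for all $N \geq 1$, one has $$a_k^N(\mu) = - \frac{1}{2} \left\langle W_N(0) , \varphi_k \right\rangle.$$
   Context: All functions are real-valued. $\langle\cdot,\cdot\rangle$ is the $L^2(0,1)$ scalar product. $A = -\frac{\mathrm{d}^2}{\mathrm{d}x^2}$ is the Dirichlet Laplacian on $(0,1)$ with domain $D(A) = H^2 \cap H_0^1(0,1)$, and $D(A^\infty) = \bigcap_{n\ge0} D(A^{n/2})$, a Fréchet space for the norms $\Vert\mu\Vert_{H^n_{(0)}}^2 = \sum_{j\ge1}\lambda_j^n\langle\mu,\varphi_j\rangle^2$, $n \geq 0$, where for $j\ge 1$, $\lambda_j = (j\pi)^2$ and $\varphi_j(x) = \sqrt{2}\sin(j\pi x)$. Lie brackets: for a Fréchet space $E$ and $f,g\in C^1(E,E)$, $[f,g]:E\to E$ is defined by $[f,g](y) = \mathrm{d}g(y)(f(y)) - \mathrm{d}f(y)(g(y))$, where $\mathrm{d}f(y),\mathrm{d}g(y)$ are the differentials at $y$. One sets $\mathrm{ad}_f^0(g)=g$ and $\mathrm{ad}_f^{n+1}(g) = [f,\mathrm{ad}_f^n(g)]$ (whenever $\mathrm{ad}_f^n(g)\in C^1(E,E)$ is well-defined). Here $E = D(A^\infty)$.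 Lucas's triangle coefficients: $\begin{bmatrix} n \\ 0 \end{bmatrix} = 1$ for $n\ge0$, and $\begin{bmatrix} n \\ p \end{bmatrix} = \binom{n}{p}+\binom{n-1}{p-1}$ for $n\ge1$, $1\le p\le n$. For $k\ge 1$, $n\ge1$, $$a_k^n(\mu) = -\frac12 \sum_{\alpha=0}^{n-1}\sum_{\beta=0}^{n-1-\alpha} (-1)^{n+\beta}\begin{bmatrix} n-1-\beta \\ \alpha \end{bmatrix}\lambda_k^{n-1-\alpha-\beta}\left\langle \mu^{(2\beta)}\mu^{(2(n-1+\alpha))},\varphi_k'\right\rangle .$$ *)

theory Defs
  imports "HOL-Analysis.Analysis"
begin

section \<open>The Dirichlet Laplacian on $(0,1)$: spectral scale\<close>

definition L2_set01 :: "(real \<Rightarrow> real) set" where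
  "L2_set01 = {f. set_borel_measurable lebesgue {0<..<1} f \<and>
                  set_integrable lebesgue {0<..<1} (\<lambda>x. (f x)\<^sup>2)}"

definition ip :: "(real \<Rightarrow> real) \<Rightarrow> (real \<Rightarrow> real) \<Rightarrow> real" where
  "ip f g = (LINT x:{0<..<1}|lebesgue. f x * g x)"

definition lam :: "nat \<Rightarrow> real" where
  "lam j = (real j * pi)\<^sup>2"

definition phi :: "nat \<Rightarrow> real \<Rightarrow> real" where
  "phi j x = sqrt 2 * sin (real j * pi * x)"

text \<open>The domain of \<open>A\<^sup>n\<^sup>/\<^sup>2\<close>, given by the spectral decomposition of \<open>A\<close>
  (eigenvalues \<open>lam j\<close>, Hilbert basis \<open>phi j\<close>, for \<open>j \<ge> 1\<close>; hence the \<open>Suc\<close>).\<close>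

definition dom_A_half :: "nat \<Rightarrow> (real \<Rightarrow> real) set" where
  "dom_A_half n = {f \<in> L2_set01. summable (\<lambda>j. lam (Suc j) ^ n * (ip f (phi (Suc j)))\<^sup>2)}"

text \<open>An element of \<open>D(A\<^sup>\<infinity>)\<close> is a class of functions modulo equality almost everywhere.
  Such a class contains exactly one function that is continuous on \<open>[0,1]\<close>
  (it is then smooth on \<open>[0,1]\<close>); this function, set to \<open>0\<close> outside \<open>[0,1]\<close>,
  is taken as the representative.\<close>

definition DAinf_set :: "(real \<Rightarrow> real) set" where
  "DAinf_set = {f \<in> (\<Inter>n. dom_A_half n). continuous_on {0..1} f \<and> (\<forall>x. x \<notin> {0..1} \<longrightarrow> f x = 0)}"

lemma continuous_imp_integrable01:
  fixes f :: "real \<Rightarrow> real"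
  assumes "continuous_on {0..1} f"
  shows "set_integrable lebesgue {0<..<1} f"
proof -
  have "set_integrable lborel {0..1} f"
    using assms by (rule borel_integrable_atLeastAtMost')
  then have "set_integrable lborel {0<..<1} f"
    by (rule set_integrable_subset) auto
  then show ?thesis
    unfolding set_integrable_def by (auto simp: integrable_completion)
qed

lemma continuous_imp_L2:
  assumes "continuous_on {0..1} f"
  shows "f \<in> L2_set01"
  using continuous_imp_integrable01[OF assms]
    continuous_imp_integrable01[OF continuous_on_power[OF assms, of 2]]
  by (auto simp: L2_set01_def set_integrable_def set_borel_measurable_def)

lemma continuous_ip_integrable:
  assumes "continuous_on {0..1} f"
  shows "set_integrable lebesgue {0<..<1} (\<lambda>x. f x * phi j x)"
  unfolding phi_def by (intro continuous_imp_integrable01 continuous_intros assms)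

lemma DAinf_set_iff:
  "f \<in> DAinf_set \<longleftrightarrow> continuous_on {0..1} f \<and> (\<forall>x. x \<notin> {0..1} \<longrightarrow> f x = 0) \<and>
     (\<forall>n. summable (\<lambda>j. lam (Suc j) ^ n * (ip f (phi (Suc j)))\<^sup>2))"
  using continuous_imp_L2 by (auto simp: DAinf_set_def dom_A_half_def)

lemma lam_nonneg: "0 \<le> lam j"
  by (simp add: lam_def)

lemma DAinf_set_zero: "(\<lambda>_. 0) \<in> DAinf_set"
  by (simp add: DAinf_set_iff ip_def)

lemma DAinf_set_add:
  assumes "f \<in> DAinf_set" "g \<in> DAinf_set"
  shows "(\<lambda>x. f x + g x) \<in> DAinf_set"
proof -
  have c: "continuous_on {0..1} f" "continuous_on {0..1} g"
    using assms by (auto simp: DAinf_set_iff)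
  have ip: "ip (\<lambda>x. f x + g x) (phi j) = ip f (phi j) + ip g (phi j)" for j
    unfolding ip_def distrib_right
    by (rule set_integral_add(2)[OF continuous_ip_integrable continuous_ip_integrable]) (use c in auto)
  have "summable (\<lambda>j. lam (Suc j) ^ n * (ip (\<lambda>x. f x + g x) (phi (Suc j)))\<^sup>2)" for n
  proof (rule summable_comparison_test')
    show "summable (\<lambda>j. 2 * (lam (Suc j) ^ n * (ip f (phi (Suc j)))\<^sup>2)
                      + 2 * (lam (Suc j) ^ n * (ip g (phi (Suc j)))\<^sup>2))"
      using assms by (intro summable_add summable_mult) (auto simp: DAinf_set_iff)
    show "norm (lam (Suc j) ^ n * (ip (\<lambda>x. f x + g x) (phi (Suc j)))\<^sup>2)
        \<le> 2 * (lam (Suc j) ^ n * (ip f (phi (Suc j)))\<^sup>2)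
            + 2 * (lam (Suc j) ^ n * (ip g (phi (Suc j)))\<^sup>2)" for j
    proof -
      have sq: "(a + b)\<^sup>2 \<le> 2 * a\<^sup>2 + 2 * b\<^sup>2" for a b :: real
        using sum_squares_bound[of a b] by (simp add: power2_sum)
      show ?thesis
        using mult_left_mono[OF sq[of "ip f (phi (Suc j))" "ip g (phi (Suc j))"], of "lam (Suc j) ^ n"]
        by (simp add: ip lam_nonneg algebra_simps)
    qed
  qed
  then show ?thesis
    using assms by (auto simp: DAinf_set_iff intro!: continuous_intros)
qed

lemma DAinf_set_scale:
  assumes "f \<in> DAinf_set"
  shows "(\<lambda>x. c * f x) \<in> DAinf_set"
proof -
  have ip: "ip (\<lambda>x. c * f x) (phi j) = c * ip f (phi j)" for j
    by (simp add: ip_def mult.assoc)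
  have "summable (\<lambda>j. c\<^sup>2 * (lam (Suc j) ^ n * (ip f (phi (Suc j)))\<^sup>2))" for n
    using assms by (intro summable_mult) (auto simp: DAinf_set_iff)
  then show ?thesis
    using assms by (auto simp: DAinf_set_iff ip power_mult_distrib mult.left_commute intro!: continuous_intros)
qed

section \<open>The space \<open>D(A\<^sup>\<infinity>)\<close>\<close>

typedef DAinf = DAinf_set
  morphisms fn to_DAinf
  using DAinf_set_zero by blast

setup_lifting type_definition_DAinf

instantiation DAinf :: real_vector
begin

lift_definition zero_DAinf :: DAinf is "\<lambda>_. 0"
  by (rule DAinf_set_zero)

lift_definition plus_DAinf :: "DAinf \<Rightarrow> DAinf \<Rightarrow> DAinf" is "\<lambda>f g x. f x + g x"
  by (rule DAinf_set_add)

lift_definition scaleR_DAinf :: "real \<Rightarrow> DAinf \<Rightarrow> DAinf" is "\<lambda>c f x. c * f x"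
  by (rule DAinf_set_scale)

lift_definition uminus_DAinf :: "DAinf \<Rightarrow> DAinf" is "\<lambda>f x. - f x"
  using DAinf_set_scale[of _ "-1"] by simp

lift_definition minus_DAinf :: "DAinf \<Rightarrow> DAinf \<Rightarrow> DAinf" is "\<lambda>f g x. f x - g x"
  using DAinf_set_add[OF _ DAinf_set_scale[of _ "-1"]] by simp

instance
  by standard (transfer; simp add: fun_eq_iff algebra_simps)+

end

definition hnorm :: "nat \<Rightarrow> DAinf \<Rightarrow> real" where
  "hnorm n u = sqrt (\<Sum>j. lam (Suc j) ^ n * (ip (fn u) (phi (Suc j)))\<^sup>2)"

text \<open>The locally convex topology defined by the family of norms \<open>hnorm n\<close>, \<open>n \<ge> 0\<close>.\<close>

instantiation DAinf :: topological_space
begin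

definition open_DAinf :: "DAinf set \<Rightarrow> bool" where
  "open_DAinf U \<longleftrightarrow>
     (\<forall>u\<in>U. \<exists>m. \<exists>e>0. \<forall>v. (\<forall>n\<le>m. hnorm n (v - u) < e) \<longrightarrow> v \<in> U)"

instance
proof
  show "open (UNIV :: DAinf set)"
    by (auto simp: open_DAinf_def intro: exI[of _ 1])
next
  fix S T :: "DAinf set"
  assume S: "open S" and T: "open T"
  show "open (S \<inter> T)"
    unfolding open_DAinf_def
  proof
    fix u assume u: "u \<in> S \<inter> T"
    obtain m e where 1: "e > 0" "\<And>v. (\<forall>n\<le>m. hnorm n (v - u) < e) \<Longrightarrow> v \<in> S"
      using S u unfolding open_DAinf_def by blast
    obtain m' e' where 2: "e' > 0" "\<And>v. (\<forall>n\<le>m'. hnorm n (v - u) < e') \<Longrightarrow> v \<in> T"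
      using T u unfolding open_DAinf_def by blast
    show "\<exists>m. \<exists>e>0. \<forall>v. (\<forall>n\<le>m. hnorm n (v - u) < e) \<longrightarrow> v \<in> S \<inter> T"
      using 1 2 by (intro exI[of _ "max m m'"] exI[of _ "min e e'"]) auto
  qed
next
  fix K :: "DAinf set set"
  assume "\<forall>S\<in>K. open S"
  then show "open (\<Union>K)"
    unfolding open_DAinf_def by (meson Union_iff)
qed

end

section \<open>Differential calculus and Lie brackets\<close>

text \<open>Calculus in Frechet spaces in the sense of Michal--Bastiani/Hamilton: a map is \<open>C\<^sup>1\<close> if all
  directional derivatives exist and \<open>(y, h) \<mapsto> dF(y)(h)\<close> is jointly continuous (linearity
  of \<open>dF(y)\<close> is then automatic). The type classes do not include Hausdorff separation, so the
  limit is chosen by a definite description; on \<open>DAinf\<close> limits are unique, \<open>hnorm 0\<close> being a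
  norm.\<close>

definition has_dir_derivative ::
  "('a \<Rightarrow> 'a) \<Rightarrow> 'a \<Rightarrow> 'a \<Rightarrow> 'a::{real_vector,topological_space} \<Rightarrow> bool" where
  "has_dir_derivative F y h d \<longleftrightarrow> ((\<lambda>t::real. (F (y + t *\<^sub>R h) - F y) /\<^sub>R t) \<longlongrightarrow> d) (at 0)"

definition differential ::
  "('a \<Rightarrow> 'a) \<Rightarrow> 'a \<Rightarrow> 'a \<Rightarrow> 'a::{real_vector,topological_space}" where
  "differential F y h = (THE d. has_dir_derivative F y h d)"

definition C1_map :: "('a::{real_vector,topological_space} \<Rightarrow> 'a) \<Rightarrow> bool" where
  "C1_map F \<longleftrightarrow> (\<forall>y h. \<exists>d. has_dir_derivative F y h d) \<and>
                continuous_on UNIV (\<lambda>(y, h). differential F y h)"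

definition lie_bracket ::
  "('a \<Rightarrow> 'a) \<Rightarrow> ('a \<Rightarrow> 'a) \<Rightarrow> 'a \<Rightarrow> 'a::{real_vector,topological_space}" where
  "lie_bracket f g y = differential g y (f y) - differential f y (g y)"

primrec ad_iter ::
  "('a \<Rightarrow> 'a) \<Rightarrow> nat \<Rightarrow> ('a \<Rightarrow> 'a) \<Rightarrow> 'a \<Rightarrow> 'a::{real_vector,topological_space}" where
  "ad_iter f 0 g = g"
| "ad_iter f (Suc n) g = lie_bracket f (ad_iter f n g)"

section \<open>The vector field and the coefficients\<close>

text \<open>Derivative on \<open>[0,1]\<close>, one-sided at the end points, extended by \<open>0\<close> as in \<open>DAinf_set\<close>.\<close>

definition D01 :: "(real \<Rightarrow> real) \<Rightarrow> real \<Rightarrow> real" where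
  "D01 f x = (if x \<in> {0..1} then vector_derivative f (at x within {0..1}) else 0)"

definition f0_fun :: "(real \<Rightarrow> real) \<Rightarrow> real \<Rightarrow> real" where
  "f0_fun y x = (D01 ^^ 2) y x - y x * D01 y x"

text \<open>Meaningful because \<open>f0_fun\<close> maps \<open>DAinf_set\<close> to itself.\<close>

definition f0 :: "DAinf \<Rightarrow> DAinf" where
  "f0 y = to_DAinf (f0_fun (fn y))"

definition lucas_triangle :: "nat \<Rightarrow> nat \<Rightarrow> nat" where
  "lucas_triangle n p = (if p = 0 then 1 else (n choose p) + ((n - 1) choose (p - 1)))"

text \<open>Used for \<open>k \<ge> 1\<close> and \<open>n \<ge> 1\<close>, where no subtraction below truncates.\<close>

definition a_coeff :: "nat \<Rightarrow> nat \<Rightarrow> (real \<Rightarrow> real) \<Rightarrow> real" where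
  "a_coeff k n mu = - (1/2) *
     (\<Sum>\<alpha>=0..n-1. \<Sum>\<beta>=0..n-1-\<alpha>.
        (-1) ^ (n + \<beta>) * real (lucas_triangle (n-1-\<beta>) \<alpha>) * lam k ^ (n-1-\<alpha>-\<beta>) *
        ip (\<lambda>x. (D01 ^^ (2*\<beta>)) mu x * (D01 ^^ (2*(n-1+\<alpha>))) mu x) (deriv (phi k)))"

end

theory Submission
  imports Defs
begin

text \<open>Write \<open>Lap u = u''\<close> and \<open>dprod u v = (u v)'\<close>, so that \<open>f0 y = Lap y - dprod y y / 2\<close>.

  An element of the space is a function that is smooth on \<open>[0,1]\<close> and all of whose even
  derivatives vanish at both end points (\<open>DAinf_set_iff_smooth\<close>): smoothness and the boundary
  values come from the sine series, which represents the function because the sines are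
  complete (\<open>sine_coefficients_zero_imp_zero\<close>), and the converse is repeated integration by
  parts. The same two arguments show that the topology is that of uniform convergence of all
  derivatives (\<open>tendsto_DAinf_iff\<close>). Hence \<open>Lap\<close> and \<open>dprod\<close> act continuously on the space,
  whereas \<open>u'\<close> and \<open>u v\<close> in general lie outside it.

  The brackets \<open>M n\<close> satisfy
  \<open>M (n + 1) y = d(M n)(y)(f0 y) - Lap (M n y) + dprod y (M n y)\<close>. They are polynomial maps built from \<open>Lap\<close> and \<open>dprod\<close>, a class that is differentiable and closed
  under this recursion (\<open>diff_poly_has_derivative\<close>); so all of them are \<open>C\<^sup>1\<close>.

  Only the value and the linear part of \<open>M n\<close> at the origin enter \<open>W N 0\<close>. Since \<open>f0 0 = 0\<close>, the value
  is \<open>(-1)\<^sup>n Lap\<^sup>n mu\<close> and the linear parts \<open>L n\<close> obey the closed recursion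
  \<open>L (n + 1) h = L n (Lap h) - Lap (L n h) + (-1)\<^sup>n dprod h (Lap\<^sup>n mu)\<close>
  (\<open>differential_ad_f0_Suc_zero\<close>). Against \<open>phi k\<close> the outer \<open>Lap\<close> becomes multiplication by
  \<open>- lam k\<close>, so that the recursion is solved by the binomial expansion of the powers of
  \<open>Lap + lam k\<close> (\<open>ip_differential_ad_f0\<close>). Finally
  \<open>W N 0 = (-1)\<^bsup>N-1\<^esup> (L N (Lap\<^bsup>N-1\<^esup> mu) + L (N - 1) (Lap\<^sup>N mu))\<close>, and the two binomial sums, one shifted
  against the other, add up to Lucas's triangle (\<open>ip_bracket_eq_lucas_sum\<close>).\<close>

section \<open>Repeated differentiation on the closed interval\<close>

definition smooth01 :: "(real \<Rightarrow> real) \<Rightarrow> bool" where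
  "smooth01 f \<longleftrightarrow> (\<forall>m. \<forall>x\<in>{0..1}.
     ((D01 ^^ m) f has_real_derivative (D01 ^^ Suc m) f x) (at x within {0..1}))"

lemma smooth01D:
  assumes "smooth01 f" "x \<in> {0..1}"
  shows "((D01 ^^ m) f has_real_derivative D01 ((D01 ^^ m) f) x) (at x within {0..1})"
  using assms unfolding smooth01_def by simp

lemma smooth01_continuous: "smooth01 f \<Longrightarrow> continuous_on {0..1} ((D01 ^^ m) f)"
  by (rule DERIV_continuous_on[OF smooth01D])

lemma D01_eqI:
  assumes "(f has_real_derivative d) (at x within {0..1})" "x \<in> {0..1}"
  shows "D01 f x = d"
  using assms vector_derivative_within_cbox[of 0 1 x f d]
  by (simp add: D01_def has_real_derivative_iff_has_vector_derivative)

lemma D01_iter_outside: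
  assumes "\<And>x. x \<notin> {0..1} \<Longrightarrow> f x = 0" "x \<notin> {0..1}"
  shows "(D01 ^^ m) f x = 0"
  using assms by (cases m) (auto simp: D01_def)

text \<open>Iterated derivatives are computed by exhibiting a sequence in which every member is the
  derivative of the preceding one; the derivatives of \<open>f\<close> can then be nothing else.\<close>

lemma
  assumes g: "\<And>m x. x \<in> {0..1} \<Longrightarrow> (g m has_real_derivative g (Suc m) x) (at x within {0..1})"
    and f: "\<And>x. x \<in> {0..1} \<Longrightarrow> f x = g 0 x"
  shows jet_eq: "x \<in> {0..1} \<Longrightarrow> (D01 ^^ m) f x = g m x"
    and jet_smooth01: "smooth01 f"
proof -
  have eq: "\<forall>x\<in>{0..1}. (D01 ^^ m) f x = g m x" for m
  proof (induction m)
    case (Suc m)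
    show ?case
    proof
      fix x :: real assume x: "x \<in> {0..1}"
      have "((D01 ^^ m) f has_real_derivative g (Suc m) x) (at x within {0..1})"
        using g[OF x, of m] Suc x
        by (subst has_field_derivative_cong_eventually[of _ "g m"])
           (auto simp: eventually_at_filter)
      then show "(D01 ^^ Suc m) f x = g (Suc m) x"
        using D01_eqI x by simp
    qed
  qed (use f in auto)
  show "(D01 ^^ m) f x = g m x" if "x \<in> {0..1}"
    using eq that by blast
  show "smooth01 f"
    unfolding smooth01_def
  proof (intro allI ballI)
    fix m and x :: real assume x: "x \<in> {0..1}"
    show "((D01 ^^ m) f has_real_derivative (D01 ^^ Suc m) f x) (at x within {0..1})"
      using g[OF x, of m] eq x
      by (subst has_field_derivative_cong_eventually[of _ "g m"])
         (auto simp: eventually_at_filter simp del: funpow.simps)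
  qed
qed

lemma D01_iter_add:
  assumes "smooth01 f" "smooth01 g"
  shows "x \<in> {0..1} \<Longrightarrow> (D01 ^^ m) (\<lambda>x. f x + g x) x = (D01 ^^ m) f x + (D01 ^^ m) g x"
proof -
  let ?g = "\<lambda>m x. (D01 ^^ m) f x + (D01 ^^ m) g x"
  have D: "(?g m has_real_derivative ?g (Suc m) x) (at x within {0..1})" if "x \<in> {0..1}" for m x
    using DERIV_add[OF smooth01D smooth01D, OF assms(1) that assms(2) that] by simp
  show "x \<in> {0..1} \<Longrightarrow> (D01 ^^ m) (\<lambda>x. f x + g x) x = ?g m x"
    by (rule jet_eq[where g = ?g, OF D]) auto
qed

lemma D01_iter_cmult:
  assumes "smooth01 f"
  shows "x \<in> {0..1} \<Longrightarrow> (D01 ^^ m) (\<lambda>x. c * f x) x = c * (D01 ^^ m) f x"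
proof -
  let ?g = "\<lambda>m x. c * (D01 ^^ m) f x"
  have D: "(?g m has_real_derivative ?g (Suc m) x) (at x within {0..1})" if "x \<in> {0..1}" for m x
    using DERIV_cmult[OF smooth01D, OF assms(1) that] by simp
  show "x \<in> {0..1} \<Longrightarrow> (D01 ^^ m) (\<lambda>x. c * f x) x = ?g m x"
    by (rule jet_eq[where g = ?g, OF D]) auto
qed

lemma D01_iter_D01_iter: "(D01 ^^ m) ((D01 ^^ k) f) = (D01 ^^ (m + k)) f"
  by (simp add: funpow_add)

lemma smooth01_D01_iter: "smooth01 f \<Longrightarrow> smooth01 ((D01 ^^ k) f)"
  unfolding smooth01_def D01_iter_D01_iter by (metis add_Suc)

text \<open>Pascal's rule for sums weighted by binomial coefficients. With \<open>a\<close> and \<open>b\<close> the derivatives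
  of two functions it is the induction step of the Leibniz rule; with \<open>a\<close> the iterates of an
  operator and \<open>b\<close> the powers of a number it expands the powers of their sum.\<close>

lemma leibniz_sum_Suc:
  fixes a b :: "nat \<Rightarrow> real"
  shows "(\<Sum>i\<le>m. real (m choose i) * (a (Suc i) * b (m - i) + a i * b (Suc (m - i))))
       = (\<Sum>i\<le>Suc m. real (Suc m choose i) * (a i * b (Suc m - i)))"
proof -
  have 1: "(\<Sum>i\<le>m. real (m choose i) * (a i * b (Suc (m - i)))) =
        a 0 * b (Suc m) + (\<Sum>i\<le>m. real (m choose Suc i) * (a (Suc i) * b (m - i)))"
  proof -
    have "(\<Sum>i\<le>m. real (m choose i) * (a i * b (Suc (m - i)))) =
          (\<Sum>i\<le>m. real (m choose i) * (a i * b (Suc m - i)))"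
      by (intro sum.cong) (auto simp: Suc_diff_le)
    also have "\<dots> = (\<Sum>i\<le>Suc m. real (m choose i) * (a i * b (Suc m - i)))"
      by simp
    also have "\<dots> = a 0 * b (Suc m) + (\<Sum>i\<le>m. real (m choose Suc i) * (a (Suc i) * b (m - i)))"
      by (subst sum.atMost_Suc_shift) simp
    finally show ?thesis .
  qed
  show ?thesis
    by (subst sum.atMost_Suc_shift) (simp add: 1 distrib_left distrib_right sum.distrib)
qed

lemma
  assumes f: "smooth01 f" and g: "smooth01 g"
  shows smooth01_mult: "smooth01 (\<lambda>x. f x * g x)"
    and D01_iter_mult: "x \<in> {0..1} \<Longrightarrow> (D01 ^^ m) (\<lambda>x. f x * g x) x
          = (\<Sum>i\<le>m. real (m choose i) * ((D01 ^^ i) f x * (D01 ^^ (m - i)) g x))"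
proof -
  let ?g = "\<lambda>m x. \<Sum>i\<le>m. real (m choose i) * ((D01 ^^ i) f x * (D01 ^^ (m - i)) g x)"
  have D: "(?g m has_real_derivative ?g (Suc m) x) (at x within {0..1})" if x: "x \<in> {0..1}" for m x
  proof -
    have "((\<lambda>x. real (m choose i) * ((D01 ^^ i) f x * (D01 ^^ (m - i)) g x)) has_real_derivative
        real (m choose i) * ((D01 ^^ Suc i) f x * (D01 ^^ (m - i)) g x + (D01 ^^ i) f x * (D01 ^^ Suc (m - i)) g x))
        (at x within {0..1})" for i
      using DERIV_cmult[OF DERIV_mult[OF smooth01D smooth01D, OF f x g x], of "real (m choose i)" i "m - i"]
      by (simp add: algebra_simps)
    then show ?thesis
      unfolding leibniz_sum_Suc[of m "\<lambda>i. (D01 ^^ i) f x" "\<lambda>i. (D01 ^^ i) g x", symmetric]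
      by (rule DERIV_sum)
  qed
  show "smooth01 (\<lambda>x. f x * g x)"
    by (rule jet_smooth01[where g = ?g, OF D]) auto
  show "x \<in> {0..1} \<Longrightarrow> (D01 ^^ m) (\<lambda>x. f x * g x) x = ?g m x"
    by (rule jet_eq[where g = ?g, OF D]) auto
qed

section \<open>Sine modes\<close>

text \<open>The derivative of order \<open>m\<close> of \<open>phi j\<close>. Shifting the phase by a quarter of a period for each
  differentiation avoids the distinction of \<open>m\<close> modulo 4.\<close>

definition dphi :: "nat \<Rightarrow> nat \<Rightarrow> real \<Rightarrow> real" where
  "dphi m j x = sqrt 2 * (real j * pi) ^ m * sin (real j * pi * x + real m * (pi / 2))"

lemma dphi_0: "dphi 0 j = phi j"
  by (simp add: dphi_def phi_def fun_eq_iff)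

lemma dphi_Suc: "(dphi m j has_real_derivative dphi (Suc m) j x) (at x within S)"
proof -
  have "sin (real j * pi * x + real (Suc m) * (pi / 2)) = cos (real j * pi * x + real m * (pi / 2))"
    by (simp add: sin_add cos_add distrib_right distrib_left algebra_simps add_divide_distrib)
  then show ?thesis
    unfolding dphi_def
    by (auto intro!: derivative_eq_intros)
qed

lemma continuous_on_dphi: "continuous_on S (dphi m j)"
  by (rule DERIV_continuous_on[OF dphi_Suc])

lemma continuous_on_phi: "continuous_on S (phi j)"
  using continuous_on_dphi[of S 0 j] by (simp add: dphi_0)

lemma deriv_phi: "deriv (phi j) = dphi 1 j"
  using DERIV_imp_deriv[OF dphi_Suc[of 0 j _ UNIV]] by (auto simp: dphi_0 fun_eq_iff)

lemma dphi_2: "dphi 2 j x = - lam j * phi j x"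
  by (simp add: dphi_def phi_def lam_def)

lemma dphi_bound: "\<bar>dphi m j x\<bar> \<le> sqrt 2 * (real j * pi) ^ m"
  using mult_left_mono[OF abs_sin_le_one, of "sqrt 2 * (real j * pi) ^ m"]
  by (simp add: dphi_def abs_mult)

lemma dphi_even_endpoint: "dphi (2 * m) j 0 = 0" "dphi (2 * m) j 1 = 0"
proof -
  have "sin (real j * pi + real m * pi) = 0"
    using sin_npi[of "j + m"] by (simp add: distrib_right)
  then show "dphi (2 * m) j 0 = 0" "dphi (2 * m) j 1 = 0"
    by (simp_all add: dphi_def)
qed

lemma phi_endpoint: "phi j 0 = 0" "phi j 1 = 0"
  using dphi_even_endpoint[of 0 j] by (simp_all add: dphi_0)

lemma continuous_on_01_bound:
  fixes f :: "real \<Rightarrow> real"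
  assumes "continuous_on {0..1} f"
  obtains b where "\<And>x. x \<in> {0..1} \<Longrightarrow> \<bar>f x\<bar> \<le> b"
proof -
  have "bounded (f ` {0..1})"
    using compact_continuous_image[OF assms] by (simp add: compact_imp_bounded)
  then obtain b where "\<forall>y\<in>f ` {0..1}. norm y \<le> b"
    unfolding bounded_iff by blast
  then show ?thesis by (intro that[of b]) simp
qed

lemma ip_eq_integral:
  assumes "continuous_on {0..1} f" "continuous_on {0..1} g"
  shows "ip f g = integral {0..1} (\<lambda>x. f x * g x)"
  unfolding ip_def integral_open_interval_real
  by (intro set_lebesgue_integral_eq_integral continuous_imp_integrable01 continuous_intros assms)

lemma ip_cong:
  assumes "\<And>x. x \<in> {0..1} \<Longrightarrow> f x = f' x" "\<And>x. x \<in> {0..1} \<Longrightarrow> g x = g' x"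
  shows "ip f g = ip f' g'"
  unfolding ip_def using assms by (intro set_lebesgue_integral_cong) auto

lemma ip_add_left:
  assumes "continuous_on {0..1} f" "continuous_on {0..1} g" "continuous_on {0..1} h"
  shows "ip (\<lambda>x. f x + g x) h = ip f h + ip g h"
  unfolding ip_def distrib_right
  by (intro set_integral_add(2) continuous_imp_integrable01 continuous_intros assms)

lemma ip_diff_left:
  assumes "continuous_on {0..1} f" "continuous_on {0..1} g" "continuous_on {0..1} h"
  shows "ip (\<lambda>x. f x - g x) h = ip f h - ip g h"
  unfolding ip_def left_diff_distrib
  by (intro set_integral_diff(2) continuous_imp_integrable01 continuous_intros assms)

lemma ip_cmult_left: "ip (\<lambda>x. c * f x) h = c * ip f h"
  by (simp add: ip_def mult.assoc)

lemma ip_phi_bound: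
  assumes f: "continuous_on {0..1} f" and s: "\<And>x. x \<in> {0..1} \<Longrightarrow> \<bar>f x\<bar> \<le> s"
  shows "\<bar>ip f (phi j)\<bar> \<le> sqrt 2 * s"
proof -
  have "norm (integral (cbox 0 1) (\<lambda>x. f x * phi j x)) \<le> s * sqrt 2 * measure lborel (cbox 0 (1::real))"
  proof (rule integrable_bound)
    show "0 \<le> s * sqrt 2" using s[of 0] by simp
    show "(\<lambda>x. f x * phi j x) integrable_on cbox 0 1"
      by (rule integrable_continuous) (auto intro!: continuous_intros f continuous_on_phi)
    fix x :: real assume "x \<in> cbox 0 1"
    then show "norm (f x * phi j x) \<le> s * sqrt 2"
      using s[of x] dphi_bound[of 0 j x] by (auto simp: abs_mult dphi_0 intro!: mult_mono)
  qed
  then show ?thesis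
    by (simp add: ip_eq_integral[OF f continuous_on_phi] mult.commute)
qed

lemma ip_by_parts:
  assumes f: "\<And>x. x \<in> {0..1} \<Longrightarrow> (f has_real_derivative f' x) (at x within {0..1})"
    and g: "\<And>x. x \<in> {0..1} \<Longrightarrow> (g has_real_derivative g' x) (at x within {0..1})"
    and f': "continuous_on {0..1} f'" and g': "continuous_on {0..1} g'"
    and ends: "f 0 * g 0 = 0" "f 1 * g 1 = 0"
  shows "ip f' g = - ip f g'"
proof -
  have c: "continuous_on {0..1} f" "continuous_on {0..1} g"
    using DERIV_continuous_on[OF f] DERIV_continuous_on[OF g] by auto
  have "((\<lambda>x. f' x * g x + f x * g' x) has_integral (f 1 * g 1 - f 0 * g 0)) {0..1}"
    by (rule fundamental_theorem_of_calculus)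
       (auto simp: has_real_derivative_iff_has_vector_derivative[symmetric]
             intro!: derivative_eq_intros f g)
  then have "integral {0..1} (\<lambda>x. f' x * g x + f x * g' x) = 0"
    using ends by auto
  moreover have "integral {0..1} (\<lambda>x. f' x * g x + f x * g' x)
      = integral {0..1} (\<lambda>x. f' x * g x) + integral {0..1} (\<lambda>x. f x * g' x)"
    by (intro integral_add integrable_continuous_real continuous_intros c f' g')
  ultimately show ?thesis
    by (simp add: ip_eq_integral c f' g')
qed

text \<open>The factor \<open>phi k\<close> makes the boundary terms vanish.\<close>

lemma ip_D01_phi:
  assumes "smooth01 f"
  shows "ip (D01 f) (phi k) = - ip f (deriv (phi k))"
  unfolding deriv_phi
proof (rule ip_by_parts)
  show "(phi k has_real_derivative dphi 1 k x) (at x within {0..1})" for x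
    using dphi_Suc[of 0 k x] by (simp add: dphi_0)
qed (use assms smooth01D[of f _ 0] smooth01_continuous[of f 1] in
      \<open>auto simp: phi_endpoint continuous_on_dphi\<close>)

text \<open>The first integration by parts uses the zeros of \<open>phi k\<close>, the second those of \<open>f\<close>.\<close>

lemma ip_D01_D01_phi:
  assumes f: "smooth01 f" and "f 0 = 0" "f 1 = 0"
  shows "ip (D01 (D01 f)) (phi k) = - lam k * ip f (phi k)"
proof -
  have "ip (D01 (D01 f)) (phi k) = - ip (D01 f) (dphi 1 k)"
    using ip_D01_phi[of "D01 f" k] smooth01_D01_iter[OF f, of 1] by (simp add: deriv_phi)
  also have "ip (D01 f) (dphi 1 k) = - ip f (dphi 2 k)"
    by (rule ip_by_parts)
       (use assms smooth01D[of f _ 0] smooth01_continuous[of f 1] dphi_Suc[of 1 k] in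
         \<open>auto simp: continuous_on_dphi numeral_2_eq_2\<close>)
  also have "ip f (dphi 2 k) = ip f (\<lambda>x. - lam k * phi k x)"
    by (rule ip_cong) (auto simp: dphi_2)
  also have "\<dots> = - lam k * ip f (phi k)"
    using ip_cmult_left[of "- lam k" f "phi k"] by (simp add: ip_def mult_ac)
  finally show ?thesis by simp
qed

text \<open>For a smooth function this condition says that its odd reflections at both end points
  are smooth.\<close>

definition even_jets_vanish :: "(real \<Rightarrow> real) \<Rightarrow> bool" where
  "even_jets_vanish f \<longleftrightarrow> (\<forall>m. (D01 ^^ (2 * m)) f 0 = 0 \<and> (D01 ^^ (2 * m)) f 1 = 0)"

lemma ip_even_derivative_phi:
  assumes f: "smooth01 f" "even_jets_vanish f"
  shows "ip ((D01 ^^ (2 * m)) f) (phi k) = (- lam k) ^ m * ip f (phi k)"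
proof (induction m)
  case (Suc m)
  have "ip ((D01 ^^ (2 * Suc m)) f) (phi k) = - lam k * ip ((D01 ^^ (2 * m)) f) (phi k)"
    using ip_D01_D01_phi[OF smooth01_D01_iter[OF f(1)], of "2 * m" k] f(2)
    by (simp add: even_jets_vanish_def)
  then show ?case by (simp add: Suc)
qed simp

section \<open>Orthonormality and completeness of the sine modes\<close>

lemma integral_cos_pi: "integral {0..1} (\<lambda>x. cos (of_int m * pi * x)) = (if m = 0 then 1 else 0)"
proof (cases "m = 0")
  case False
  have "((\<lambda>x. cos (of_int m * pi * x)) has_integral
      sin (of_int m * pi * 1) / (of_int m * pi) - sin (of_int m * pi * 0) / (of_int m * pi)) {0..1}"
    by (rule fundamental_theorem_of_calculus)
       (use False in \<open>auto simp: has_real_derivative_iff_has_vector_derivative[symmetric]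
             intro!: derivative_eq_intros\<close>)
  moreover have "sin (of_int m * pi) = 0"
    by (simp add: sin_zero_iff_int2)
  ultimately show ?thesis using False by (auto simp: integral_unique)
qed simp

lemma ip_phi_phi:
  assumes "j \<ge> 1" "k \<ge> 1"
  shows "ip (phi j) (phi k) = (if j = k then 1 else 0)"
proof -
  let ?c = "\<lambda>m x. cos (real_of_int m * pi * x)"
  have "ip (phi j) (phi k) = integral {0..1} (\<lambda>x. ?c (int j - int k) x - ?c (int j + int k) x)"
    unfolding ip_eq_integral[OF continuous_on_phi continuous_on_phi]
    by (rule arg_cong[of _ _ "integral _"]) (auto simp: phi_def fun_eq_iff cos_diff cos_add algebra_simps)
  also have "\<dots> = integral {0..1} (?c (int j - int k)) - integral {0..1} (?c (int j + int k))"
    by (intro integral_diff integrable_continuous_real continuous_intros)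
  finally show ?thesis
    using assms unfolding integral_cos_pi by auto
qed

text \<open>Completeness of the sines among continuous functions. The functions
  \<open>sin (\<pi> x) cos (\<pi> x)\<^sup>n\<close> are combinations of sine modes, so \<open>f\<close> is orthogonal to
  \<open>sin (\<pi> x) p (cos (\<pi> x))\<close> for every polynomial \<open>p\<close>. As \<open>cos (\<pi> x)\<close> is a coordinate
  on \<open>[0,1]\<close>, Weierstrass approximation allows \<open>p (cos (\<pi> x))\<close> to approach \<open>f\<close> itself, and
  \<open>\<integral> sin (\<pi> x) f\<^sup>2 = 0\<close> with a weight that is positive inside the interval.\<close>

lemma sine_coefficients_zero_imp_zero:
  assumes f: "continuous_on {0..1} f" and z: "\<And>j. j \<ge> 1 \<Longrightarrow> ip f (phi j) = 0"
    and x: "x \<in> {0..1}"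
  shows "f x = 0"
proof -
  have c_int: "(\<lambda>x. f x * g x) integrable_on {0..1}" if "continuous_on {0..1} g" for g
    by (intro integrable_continuous_real continuous_intros f that)
  have cos_power: "integral {0..1} (\<lambda>x. f x * (sin (real j * pi * x) * cos (pi * x) ^ n)) = 0" for n j
  proof (induction n arbitrary: j)
    case 0
    show ?case
    proof (cases "j = 0")
      case False
      then have "integral {0..1} (\<lambda>x. sqrt 2 * (f x * sin (real j * pi * x))) = 0"
        using z[of j] by (simp add: ip_eq_integral[OF f continuous_on_phi] phi_def mult.left_commute)
      then show ?thesis by simp
    qed simp
  next
    case (Suc n)
    show ?case
    proof (cases j)
      case (Suc i)
      let ?s = "\<lambda>j x. f x * (sin (real j * pi * x) * cos (pi * x) ^ n)"
      have sc: "sin (real (Suc i) * pi * x) * cos (pi * x)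
          = (sin (real (Suc (Suc i)) * pi * x) + sin (real i * pi * x)) / 2" for x
        using sin_times_cos[of "real (Suc i) * pi * x" "pi * x"] by (simp add: algebra_simps)
      have "f x * (sin (real j * pi * x) * cos (pi * x) ^ Suc n) = (?s (Suc (Suc i)) x + ?s i x) / 2" for x
      proof -
        have "f x * (sin (real j * pi * x) * cos (pi * x) ^ Suc n)
            = f x * ((sin (real (Suc i) * pi * x) * cos (pi * x)) * cos (pi * x) ^ n)"
          by (simp add: Suc mult_ac)
        then show ?thesis
          unfolding sc by (simp add: field_simps)
      qed
      then have "integral {0..1} (\<lambda>x. f x * (sin (real j * pi * x) * cos (pi * x) ^ Suc n))
          = integral {0..1} (\<lambda>x. ?s (Suc (Suc i)) x + ?s i x) / 2"
        by (simp only: integral_divide)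
      also have "integral {0..1} (\<lambda>x. ?s (Suc (Suc i)) x + ?s i x)
          = integral {0..1} (?s (Suc (Suc i))) + integral {0..1} (?s i)"
        by (intro integral_add c_int continuous_intros)
      finally show ?thesis unfolding Suc.IH by simp
    qed simp
  qed
  have poly: "integral {0..1} (\<lambda>x. f x * (sin (pi * x) * p (cos (pi * x)))) = 0"
    if p: "real_polynomial_function p" for p
  proof -
    from p obtain a n where p: "p = (\<lambda>x. \<Sum>i\<le>n. a i * x ^ i)"
      unfolding real_polynomial_function_iff_sum by auto
    have "integral {0..1} (\<lambda>x. \<Sum>i\<le>n. a i * (f x * (sin (pi * x) * cos (pi * x) ^ i))) = 0"
      using cos_power[of 1]
      by (subst integral_sum) (auto intro!: integrable_on_mult_right c_int continuous_intros)
    then show ?thesis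
      by (simp add: p sum_distrib_left mult_ac)
  qed
  \<comment> \<open>\<open>f\<close> read in the coordinate \<open>t = cos (\<pi> x)\<close>\<close>
  define g where "g t = f (arccos t / pi)" for t
  have g: "continuous_on {-1..1} g"
    unfolding g_def
    by (rule continuous_on_compose2[OF f])
       (auto intro!: continuous_intros continuous_on_arccos' simp: arccos_lbound arccos_ubound)
  have gf: "g (cos (pi * x)) = f x" if "x \<in> {0..1}" for x
    using that by (simp add: g_def arccos_cos mult_le_cancel_left1)
  obtain b where b: "\<And>x. x \<in> {0..1} \<Longrightarrow> \<bar>f x\<bar> \<le> b"
    using continuous_on_01_bound[OF f] by blast
  have b0: "0 \<le> b" using b[of 0] by simp
  let ?F = "\<lambda>x. f x * (sin (pi * x) * f x)"
  have F: "continuous_on {0..1} ?F" by (intro continuous_intros f)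
  have "\<bar>integral {0..1} ?F\<bar> \<le> e" if e: "e > 0" for e
  proof -
    \<comment> \<open>\<open>b + 1\<close> in place of \<open>b\<close> keeps the tolerance defined when \<open>f\<close> is zero\<close>
    obtain p where p: "real_polynomial_function p" "\<And>t. t \<in> {-1..1} \<Longrightarrow> \<bar>g t - p t\<bar> < e / (b + 1)"
      using Stone_Weierstrass_real_polynomial_function[OF _ g, of "e / (b + 1)"] e b0 by auto
    have pc: "continuous_on S p" for S
      using p(1) by (simp add: continuous_on_polymonial_function real_polynomial_function_eq)
    let ?P = "\<lambda>x. f x * (sin (pi * x) * p (cos (pi * x)))"
    have P: "continuous_on {0..1} ?P"
      by (intro continuous_intros f continuous_on_compose2[OF pc[of UNIV]]) auto
    have "norm (integral (cbox 0 1) (\<lambda>x. ?F x - ?P x)) \<le> e * measure lborel (cbox 0 (1::real))"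
    proof (rule integrable_bound)
      show "(\<lambda>x. ?F x - ?P x) integrable_on cbox 0 1"
        using continuous_on_diff[OF F P] by (intro integrable_continuous) simp
      fix x :: real assume "x \<in> cbox 0 1"
      then have x: "x \<in> {0..1}" by simp
      have "norm (?F x - ?P x) = \<bar>f x\<bar> * (\<bar>sin (pi * x)\<bar> * \<bar>g (cos (pi * x)) - p (cos (pi * x))\<bar>)"
        by (simp add: gf[OF x] abs_mult[symmetric] algebra_simps)
      also have "\<dots> \<le> (b + 1) * (1 * (e / (b + 1)))"
        using b[OF x] p(2)[of "cos (pi * x)"] b0 e by (intro mult_mono) auto
      finally show "norm (?F x - ?P x) \<le> e" using b0 by simp
    qed (use e in simp)
    moreover have "integral {0..1} (\<lambda>x. ?F x - ?P x) = integral {0..1} ?F - integral {0..1} ?P"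
      by (intro integral_diff integrable_continuous_real F P)
    ultimately show ?thesis by (simp add: poly[OF p(1)])
  qed
  then have int0: "integral {0..1} ?F = 0"
    using field_le_epsilon[of "\<bar>integral {0..1} ?F\<bar>" 0] by simp
  have F0: "?F x = 0" if "x \<in> {0..1}" for x
  proof (rule has_integral_0_cbox_imp_0[of 0 1 ?F])
    show "(?F has_integral 0) (cbox 0 1)"
      using integrable_integral[OF integrable_continuous_real[OF F]] by (simp add: int0)
    show "0 \<le> ?F x" if "x \<in> box 0 1" for x
    proof -
      have "0 \<le> sin (pi * x)"
        using that mult_left_mono[of x 1 pi] by (intro sin_ge_zero) auto
      then have "0 \<le> sin (pi * x) * (f x)\<^sup>2" by simp
      then show ?thesis by (simp add: power2_eq_square mult_ac)
    qed
  qed (use F that in auto)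
  have inner: "f x = 0" if "x \<in> {0<..<1}" for x
    using F0[of x] sin_gt_zero[of "pi * x"] that by (auto simp: mult_less_cancel_left1)
  show ?thesis
    using continuous_constant_on_closure[of "{0<..<1}" f 0 x] inner f x by auto
qed

section \<open>Elements of the space as functions with vanishing even jets\<close>

abbreviation sine_coeff :: "DAinf \<Rightarrow> nat \<Rightarrow> real" where
  "sine_coeff u j \<equiv> ip (fn u) (phi (Suc j))"

lemma lam_Suc_ge_1: "1 \<le> lam (Suc j)"
proof -
  have "1 * 1 \<le> real (Suc j) * pi"
    using pi_gt3 by (intro mult_mono) auto
  then show ?thesis
    unfolding lam_def by (intro one_le_power) simp
qed

lemma summable_inverse_lam: "summable (\<lambda>j. 1 / lam (Suc j))"
proof -
  have "summable (\<lambda>j. inverse (real (Suc j) ^ 2))"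
    using inverse_power_summable[of 2, where 'a = real] by (subst summable_Suc_iff) simp
  from summable_mult[OF this, of "1 / pi ^ 2"] show ?thesis
    by (simp add: lam_def power_mult_distrib divide_inverse mult.commute del: of_nat_Suc)
qed

text \<open>The spectral zeta function of \<open>A\<close> at 1. Its finiteness turns bounds on single Fourier
  coefficients into bounds on their sums.\<close>

definition lam_zeta :: real where
  "lam_zeta = (\<Sum>j. 1 / lam (Suc j))"

lemma lam_zeta_nonneg: "0 \<le> lam_zeta"
  unfolding lam_zeta_def by (intro suminf_nonneg summable_inverse_lam) (simp add: lam_nonneg)

lemma summable_hnorm: "summable (\<lambda>j. lam (Suc j) ^ n * (sine_coeff u j)\<^sup>2)"
  using fn[of u] by (simp add: DAinf_set_iff)

lemma fn_continuous: "continuous_on {0..1} (fn u)"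
  and fn_outside: "x \<notin> {0..1} \<Longrightarrow> fn u x = 0"
  using fn[of u] by (simp_all add: DAinf_set_iff)

lemma sine_coeff_le_hnorm: "(real (Suc j) * pi) ^ n * \<bar>sine_coeff u j\<bar> \<le> hnorm n u"
  unfolding hnorm_def
proof (rule real_le_rsqrt)
  have "((real (Suc j) * pi) ^ n * \<bar>sine_coeff u j\<bar>)\<^sup>2 = lam (Suc j) ^ n * (sine_coeff u j)\<^sup>2"
    by (simp only: lam_def power_mult_distrib power2_abs power_even_abs flip: power_mult)
       (simp add: mult.commute)
  also have "\<dots> \<le> (\<Sum>j. lam (Suc j) ^ n * (sine_coeff u j)\<^sup>2)"
    using sum_le_suminf[OF summable_hnorm, of "{j}" n u] by (simp add: lam_nonneg)
  finally show "((real (Suc j) * pi) ^ n * \<bar>sine_coeff u j\<bar>)\<^sup>2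
      \<le> (\<Sum>j. lam (Suc j) ^ n * (sine_coeff u j)\<^sup>2)" .
qed

text \<open>Differentiating \<open>m\<close> times costs \<open>m\<close> of the \<open>m + 2\<close> powers of the frequency that
  \<open>hnorm (m + 2) u\<close> controls; the two that are left give a summable factor.\<close>

lemma sine_series_term_bound:
  "\<bar>sine_coeff u j * dphi m (Suc j) x\<bar> \<le> sqrt 2 * hnorm (m + 2) u * (1 / lam (Suc j))"
proof -
  have l: "0 < lam (Suc j)" using lam_Suc_ge_1[of j] by simp
  have "\<bar>sine_coeff u j * dphi m (Suc j) x\<bar> * lam (Suc j)
      \<le> (\<bar>sine_coeff u j\<bar> * (sqrt 2 * (real (Suc j) * pi) ^ m)) * lam (Suc j)"
    unfolding abs_mult using dphi_bound l by (intro mult_right_mono mult_left_mono) (auto simp del: of_nat_Suc)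
  also have "\<dots> = sqrt 2 * ((real (Suc j) * pi) ^ (m + 2) * \<bar>sine_coeff u j\<bar>)"
    by (simp add: lam_def power_add power2_eq_square)
  also have "\<dots> \<le> sqrt 2 * hnorm (m + 2) u"
    by (intro mult_left_mono sine_coeff_le_hnorm) simp
  finally show ?thesis
    using l by (simp add: field_simps)
qed

lemma ip_suminf:
  assumes f: "\<And>i. continuous_on {0..1} (f i)" and g: "continuous_on {0..1} g"
    and M: "\<And>i x. x \<in> {0..1} \<Longrightarrow> \<bar>f i x\<bar> \<le> M i" "summable M"
  shows "(\<lambda>i. ip (f i) g) sums ip (\<lambda>x. \<Sum>i. f i x) g"
proof -
  have sm: "summable (\<lambda>i. f i x)" if "x \<in> {0..1}" for x
    using summable_comparison_test'[OF M(2), of 0 "\<lambda>i. f i x"] M(1)[OF that] by simp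
  have "uniform_limit {0..1} (\<lambda>n x. \<Sum>i<n. f i x) (\<lambda>x. \<Sum>i. f i x) sequentially"
    using M by (intro Weierstrass_m_test) auto
  then have lim: "continuous_on {0..1} (\<lambda>x. \<Sum>i. f i x)"
    by (rule uniform_limit_theorem[rotated]) (auto intro!: always_eventually continuous_intros f)
  obtain b where b: "\<And>x. x \<in> {0..1} \<Longrightarrow> \<bar>g x\<bar> \<le> b"
    using continuous_on_01_bound[OF g] by blast
  have "uniform_limit {0..1} (\<lambda>n x. \<Sum>i<n. f i x * g x) (\<lambda>x. \<Sum>i. f i x * g x) sequentially"
  proof (rule Weierstrass_m_test)
    show "norm (f i x * g x) \<le> M i * b" if "x \<in> {0..1}" for i x
      using M(1)[OF that, of i] b[OF that] by (auto simp: abs_mult intro!: mult_mono)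
  qed (intro summable_mult2 M)
  then obtain I J where IJ: "\<And>n. ((\<lambda>x. \<Sum>i<n. f i x * g x) has_integral I n) {0..1}"
      "((\<lambda>x. \<Sum>i. f i x * g x) has_integral J) {0..1}" "(I \<longlongrightarrow> J) sequentially"
    by (rule uniform_limit_integral) (auto intro!: continuous_intros f g)
  have "I = (\<lambda>n. \<Sum>i<n. ip (f i) g)"
  proof
    fix n
    have "I n = integral {0..1} (\<lambda>x. \<Sum>i<n. f i x * g x)"
      by (rule integral_unique[OF IJ(1), symmetric])
    also have "\<dots> = (\<Sum>i<n. integral {0..1} (\<lambda>x. f i x * g x))"
      by (intro integral_sum integrable_continuous_real continuous_intros f g) auto
    finally show "I n = (\<Sum>i<n. ip (f i) g)" by (simp add: ip_eq_integral f g)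
  qed
  moreover have "J = ip (\<lambda>x. \<Sum>i. f i x) g"
  proof -
    have "J = integral {0..1} (\<lambda>x. \<Sum>i. f i x * g x)"
      by (rule integral_unique[OF IJ(2), symmetric])
    also have "\<dots> = integral {0..1} (\<lambda>x. (\<Sum>i. f i x) * g x)"
      by (rule integral_cong) (simp add: suminf_mult2 sm)
    finally show ?thesis by (simp add: ip_eq_integral lim g)
  qed
  ultimately show ?thesis
    using IJ(3) by (simp add: sums_def)
qed

text \<open>The sine series of \<open>u\<close> converges uniformly on \<open>[0,1]\<close> after any number of termwise
  differentiations. By orthonormality its sum has the same sine coefficients as \<open>u\<close>, so the
  two agree by completeness, and \<open>u\<close> inherits the smoothness of the sum.\<close>

lemma
  shows sine_series: "x \<in> {0..1} \<Longrightarrow>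
      (\<lambda>j. sine_coeff u j * dphi m (Suc j) x) sums (D01 ^^ m) (fn u) x"
    and fn_smooth01: "smooth01 (fn u)"
proof -
  define S where "S m x = (\<Sum>j. sine_coeff u j * dphi m (Suc j) x)" for m x
  have sm_M: "summable (\<lambda>j. sqrt 2 * hnorm (m + 2) u * (1 / lam (Suc j)))" for m
    by (intro summable_mult summable_inverse_lam)
  have sums: "(\<lambda>j. sine_coeff u j * dphi m (Suc j) x) sums S m x" for m x
    unfolding S_def
    by (intro summable_sums summable_comparison_test'[OF sm_M, of 0])
       (use sine_series_term_bound in simp)
  have unif: "uniform_limit {0..1} (\<lambda>n x. \<Sum>j<n. sine_coeff u j * dphi m (Suc j) x) (S m) sequentially" for m
    unfolding S_def
    by (rule Weierstrass_m_test[OF _ sm_M]) (use sine_series_term_bound in simp)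
  have D: "(S m has_real_derivative S (Suc m) x) (at x within {0..1})" if x: "x \<in> {0..1}" for m x
  proof -
    have "\<exists>g. \<forall>x\<in>{0..1}. (\<lambda>j. sine_coeff u j * dphi m (Suc j) x) sums g x \<and>
        (g has_field_derivative S (Suc m) x) (at x within {0..1})"
      by (rule has_field_derivative_series[OF _ _ unif, where ?x0.0 = 0])
         (use sums[of m 0] in \<open>auto intro!: DERIV_cmult dphi_Suc simp: sums_iff\<close>)
    then obtain g where g: "\<And>x. x \<in> {0..1} \<Longrightarrow> (\<lambda>j. sine_coeff u j * dphi m (Suc j) x) sums g x"
        "\<And>x. x \<in> {0..1} \<Longrightarrow> (g has_field_derivative S (Suc m) x) (at x within {0..1})"
      by blast
    have "g y = S m y" if "y \<in> {0..1}" for y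
      using g(1)[OF that] sums sums_unique2 by blast
    then show ?thesis
      using g(2)[OF x] x
      by (subst has_field_derivative_cong_eventually[of _ g]) (auto simp: eventually_at_filter)
  qed
  have S0: "continuous_on {0..1} (S 0)"
    by (rule DERIV_continuous_on[OF D])
  have coeff: "ip (S 0) (phi (Suc k)) = sine_coeff u k" for k
  proof -
    have "(\<lambda>j. ip (\<lambda>x. sine_coeff u j * dphi 0 (Suc j) x) (phi (Suc k))) sums ip (S 0) (phi (Suc k))"
      unfolding S_def
      by (intro ip_suminf[OF _ _ _ sm_M[of 0]] sine_series_term_bound
            continuous_intros continuous_on_dphi continuous_on_phi)
    moreover have "ip (\<lambda>x. sine_coeff u j * dphi 0 (Suc j) x) (phi (Suc k))
        = (if j = k then sine_coeff u j else 0)" for j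
      by (simp add: ip_cmult_left dphi_0 ip_phi_phi)
    ultimately show ?thesis
      using sums_single[of k "sine_coeff u"] sums_unique2 by simp
  qed
  have "fn u x = S 0 x" if "x \<in> {0..1}" for x
  proof -
    have "ip (\<lambda>x. fn u x - S 0 x) (phi (Suc k)) = 0" for k
      by (simp add: ip_diff_left[OF fn_continuous S0 continuous_on_phi] coeff)
    then have "ip (\<lambda>x. fn u x - S 0 x) (phi j) = 0" if "j \<ge> 1" for j
      using that by (cases j) auto
    then show ?thesis
      using sine_coefficients_zero_imp_zero[of "\<lambda>x. fn u x - S 0 x" x] that
      by (force intro!: continuous_intros fn_continuous S0)
  qed
  note eq = jet_eq[of S "fn u", OF D this] and smooth = jet_smooth01[of S "fn u", OF D this]
  show "smooth01 (fn u)" by (rule smooth)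
  show "(\<lambda>j. sine_coeff u j * dphi m (Suc j) x) sums (D01 ^^ m) (fn u) x" if "x \<in> {0..1}"
    using eq[OF _ _ that, of m] sums by simp
qed

lemma fn_even_jets_vanish: "even_jets_vanish (fn u)"
proof -
  have "(D01 ^^ (2 * m)) (fn u) x = 0" if "x = 0 \<or> x = 1" for m x
  proof -
    have "(\<lambda>j. 0) sums (D01 ^^ (2 * m)) (fn u) x"
      using sine_series[of x u "2 * m"] that by (auto simp: dphi_even_endpoint)
    then show ?thesis using sums_0 sums_unique2 by blast
  qed
  then show ?thesis unfolding even_jets_vanish_def by blast
qed

text \<open>Integrating by parts \<open>2 (n + 1)\<close> times gains the factor \<open>lam\<^bsup>-(n+1)\<^esup>\<close> in the coefficient. Its
  square beats the weight \<open>lam\<^sup>n\<close> by \<open>n + 2\<close> powers of \<open>lam\<close>, of which one is kept to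
  make the bound summable; the others are at least 1.\<close>

lemma weighted_coefficient_bound:
  assumes f: "smooth01 f" "even_jets_vanish f"
    and s: "\<And>x. x \<in> {0..1} \<Longrightarrow> \<bar>(D01 ^^ (2 * (n + 1))) f x\<bar> \<le> s"
  shows "lam (Suc j) ^ n * (ip f (phi (Suc j)))\<^sup>2 \<le> 2 * s\<^sup>2 * (1 / lam (Suc j))"
proof -
  let ?l = "lam (Suc j)" and ?c = "ip f (phi (Suc j))"
  have l: "1 \<le> ?l" by (rule lam_Suc_ge_1)
  have "\<bar>?l ^ (n + 1) * ?c\<bar> \<le> sqrt 2 * s"
    using ip_phi_bound[OF smooth01_continuous[OF f(1)] s]
    by (simp add: ip_even_derivative_phi[OF f] abs_mult power_abs del: mult_Suc_right)
  then have "(?l ^ (n + 1) * ?c)\<^sup>2 \<le> (sqrt 2 * s)\<^sup>2"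
    by (rule power2_le_iff_abs_le[THEN iffD2, rotated]) (use s[of 0] in simp)
  then have 1: "(?l ^ (n + 1))\<^sup>2 * ?c\<^sup>2 \<le> 2 * s\<^sup>2"
    by (simp add: power_mult_distrib)
  have "?l ^ n * ?c\<^sup>2 * ?l = ?l ^ (n + 1) * ?c\<^sup>2" by simp
  also have "\<dots> \<le> (?l ^ (n + 1))\<^sup>2 * ?c\<^sup>2"
    using l by (intro mult_right_mono power_increasing[where n = "n + 1" and N = "(n + 1) * 2", unfolded power_mult]) auto
  also note 1
  finally show ?thesis using l by (simp add: field_simps)
qed

text \<open>The spectral definition of the space in terms of boundary values: rapid decay of the sine
  coefficients gives a smooth function, whose even derivatives are sine series again and so
  vanish at the end points; conversely these boundary values are exactly what the repeated
  integration by parts needs.\<close>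

lemma DAinf_set_iff_smooth:
  "f \<in> DAinf_set \<longleftrightarrow> smooth01 f \<and> even_jets_vanish f \<and> (\<forall>x. x \<notin> {0..1} \<longrightarrow> f x = 0)"
proof (intro iffI conjI)
  assume "f \<in> DAinf_set"
  then have f: "f = fn (to_DAinf f)"
    by (simp add: to_DAinf_inverse)
  show "smooth01 f" "even_jets_vanish f"
    using fn_smooth01[of "to_DAinf f"] fn_even_jets_vanish[of "to_DAinf f"] f by simp_all
  show "\<forall>x. x \<notin> {0..1} \<longrightarrow> f x = 0"
    using fn_outside[of _ "to_DAinf f"] f by metis
next
  assume *: "smooth01 f \<and> even_jets_vanish f \<and> (\<forall>x. x \<notin> {0..1} \<longrightarrow> f x = 0)"
  have "summable (\<lambda>j. lam (Suc j) ^ n * (ip f (phi (Suc j)))\<^sup>2)" for n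
  proof -
    obtain s where s: "\<And>x. x \<in> {0..1} \<Longrightarrow> \<bar>(D01 ^^ (2 * (n + 1))) f x\<bar> \<le> s"
      using continuous_on_01_bound[OF smooth01_continuous[of f "2 * (n + 1)"]] * by blast
    have "summable (\<lambda>j. 2 * s\<^sup>2 * (1 / lam (Suc j)))"
      by (intro summable_mult summable_inverse_lam)
    then show ?thesis
    proof (rule summable_comparison_test')
      show "norm (lam (Suc j) ^ n * (ip f (phi (Suc j)))\<^sup>2) \<le> 2 * s\<^sup>2 * (1 / lam (Suc j))" for j
      proof -
        have "0 \<le> lam (Suc j) ^ n * (ip f (phi (Suc j)))\<^sup>2"
          by (simp add: lam_nonneg)
        then show ?thesis
          using weighted_coefficient_bound[OF _ _ s, of j] * by simp
      qed
    qed
  qed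
  moreover have "continuous_on {0..1} f"
    using smooth01_continuous[of f 0] * by simp
  ultimately show "f \<in> DAinf_set"
    unfolding DAinf_set_iff using * by blast
qed

text \<open>This bound and the next one show that the norms \<open>hnorm n\<close> and the suprema of the
  derivatives dominate each other, with a finite loss of order.\<close>

lemma D01_iter_le_hnorm:
  assumes "x \<in> {0..1}"
  shows "\<bar>(D01 ^^ m) (fn u) x\<bar> \<le> sqrt 2 * lam_zeta * hnorm (m + 2) u"
proof -
  have s: "(\<lambda>j. sqrt 2 * hnorm (m + 2) u * (1 / lam (Suc j))) sums (sqrt 2 * hnorm (m + 2) u * lam_zeta)"
    unfolding lam_zeta_def by (rule sums_mult[OF summable_sums[OF summable_inverse_lam]])
  have "norm (\<Sum>j. sine_coeff u j * dphi m (Suc j) x) \<le> (\<Sum>j. sqrt 2 * hnorm (m + 2) u * (1 / lam (Suc j)))"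
    by (rule norm_suminf_le[OF _ sums_summable[OF s]]) (use sine_series_term_bound in simp)
  then show ?thesis
    using sums_unique[OF sine_series[OF assms, of u m]] sums_unique[OF s] by (simp add: mult_ac)
qed

lemma hnorm_le:
  assumes s: "\<And>x. x \<in> {0..1} \<Longrightarrow> \<bar>(D01 ^^ (2 * (n + 1))) (fn u) x\<bar> \<le> s"
  shows "hnorm n u \<le> sqrt (2 * lam_zeta) * s"
proof -
  have sm: "(\<lambda>j. 2 * s\<^sup>2 * (1 / lam (Suc j))) sums (2 * s\<^sup>2 * lam_zeta)"
    unfolding lam_zeta_def by (rule sums_mult[OF summable_sums[OF summable_inverse_lam]])
  have "(\<Sum>j. lam (Suc j) ^ n * (sine_coeff u j)\<^sup>2) \<le> (\<Sum>j. 2 * s\<^sup>2 * (1 / lam (Suc j)))"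
    by (intro suminf_le summable_hnorm sums_summable[OF sm]
          weighted_coefficient_bound fn_smooth01 fn_even_jets_vanish s)
  also have "\<dots> = (2 * lam_zeta) * s\<^sup>2"
    unfolding sums_unique[OF sm, symmetric] by simp
  finally have "hnorm n u \<le> sqrt ((2 * lam_zeta) * s\<^sup>2)"
    unfolding hnorm_def by (rule real_sqrt_le_mono)
  then show ?thesis
    using s[of 0] by (simp add: real_sqrt_mult)
qed

section \<open>The topology in terms of uniform convergence of all derivatives\<close>

lemma D01_iter_fn_add:
  "x \<in> {0..1} \<Longrightarrow> (D01 ^^ m) (fn (u + v)) x = (D01 ^^ m) (fn u) x + (D01 ^^ m) (fn v) x"
  unfolding plus_DAinf.rep_eq by (rule D01_iter_add[OF fn_smooth01 fn_smooth01])

lemma D01_iter_fn_scaleR: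
  "x \<in> {0..1} \<Longrightarrow> (D01 ^^ m) (fn (c *\<^sub>R u)) x = c * (D01 ^^ m) (fn u) x"
  unfolding scaleR_DAinf.rep_eq by (rule D01_iter_cmult[OF fn_smooth01])

lemma D01_iter_fn_diff:
  "x \<in> {0..1} \<Longrightarrow> (D01 ^^ m) (fn (u - v)) x = (D01 ^^ m) (fn u) x - (D01 ^^ m) (fn v) x"
  using D01_iter_fn_add[of x m u "(- 1) *\<^sub>R v"] D01_iter_fn_scaleR[of x m "- 1" v] by simp

lemma exists_small_multiple:
  fixes C d :: real
  assumes "0 \<le> C" "0 < d"
  obtains r where "0 < r" "C * r < d"
proof
  show "0 < d / (C + 1)" "C * (d / (C + 1)) < d"
    using assms by (simp_all add: divide_less_eq algebra_simps)
qed

text \<open>A bound \<open>s < e\<close> valid for all \<open>x\<close> expresses that the supremum is below \<open>e\<close>, and its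
  margin \<open>e - s\<close> is the room in which the centre can be moved.\<close>

lemma open_uniform_ball:
  "open {v. \<exists>s<e. \<forall>x\<in>{0..1}. \<bar>(D01 ^^ m) (fn v) x - (D01 ^^ m) (fn l) x\<bar> \<le> s}"
  unfolding open_DAinf_def
proof
  fix u assume "u \<in> {v. \<exists>s<e. \<forall>x\<in>{0..1}. \<bar>(D01 ^^ m) (fn v) x - (D01 ^^ m) (fn l) x\<bar> \<le> s}"
  then obtain s where s: "s < e" "\<And>x. x \<in> {0..1} \<Longrightarrow> \<bar>(D01 ^^ m) (fn u) x - (D01 ^^ m) (fn l) x\<bar> \<le> s"
    by blast
  define C where "C = sqrt 2 * lam_zeta"
  have C: "0 \<le> C" by (simp add: C_def lam_zeta_nonneg)
  obtain r where r: "0 < r" and "C * r < e - s"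
    using exists_small_multiple[OF C] s(1) by (metis diff_gt_0_iff_gt)
  then have Cr: "s + C * r < e" by simp
  show "\<exists>M. \<exists>r>0. \<forall>v. (\<forall>n\<le>M. hnorm n (v - u) < r) \<longrightarrow>
      v \<in> {v. \<exists>s<e. \<forall>x\<in>{0..1}. \<bar>(D01 ^^ m) (fn v) x - (D01 ^^ m) (fn l) x\<bar> \<le> s}"
  proof (rule exI[of _ "m + 2"], rule exI[of _ r], intro conjI r allI impI CollectI,
      rule exI[of _ "s + C * r"], intro conjI Cr ballI)
    fix v and x :: real
    assume v: "\<forall>n\<le>m + 2. hnorm n (v - u) < r" and x: "x \<in> {0..1}"
    have "\<bar>(D01 ^^ m) (fn v) x - (D01 ^^ m) (fn u) x\<bar> \<le> C * hnorm (m + 2) (v - u)"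
      using D01_iter_le_hnorm[OF x, of m "v - u"] by (simp add: D01_iter_fn_diff[OF x] C_def)
    also have "\<dots> \<le> C * r"
      using v C by (intro mult_left_mono) (auto intro: less_imp_le)
    finally show "\<bar>(D01 ^^ m) (fn v) x - (D01 ^^ m) (fn l) x\<bar> \<le> s + C * r"
      using s(2)[OF x] by linarith
  qed
qed

text \<open>The Frechet topology is that of uniform convergence of all derivatives. In this form the
  continuity of the algebraic operations below needs no estimate in the norms \<open>hnorm n\<close>.\<close>

lemma tendsto_DAinf_iff:
  "(f \<longlongrightarrow> l) F \<longleftrightarrow>
    (\<forall>m. uniform_limit {0..1} (\<lambda>i. (D01 ^^ m) (fn (f i))) ((D01 ^^ m) (fn l)) F)"
proof (intro iffI allI)
  fix m assume f: "(f \<longlongrightarrow> l) F"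
  show "uniform_limit {0..1} (\<lambda>i. (D01 ^^ m) (fn (f i))) ((D01 ^^ m) (fn l)) F"
    unfolding uniform_limit_iff
  proof (intro allI impI)
    fix e :: real assume e: "e > 0"
    have "\<forall>\<^sub>F i in F. f i \<in> {v. \<exists>s<e. \<forall>x\<in>{0..1}. \<bar>(D01 ^^ m) (fn v) x - (D01 ^^ m) (fn l) x\<bar> \<le> s}"
      by (rule topological_tendstoD[OF f open_uniform_ball]) (use e in auto)
    then show "\<forall>\<^sub>F i in F. \<forall>x\<in>{0..1}. dist ((D01 ^^ m) (fn (f i)) x) ((D01 ^^ m) (fn l) x) < e"
      by (rule eventually_mono) (fastforce simp: dist_real_def)
  qed
next
  assume u: "\<forall>m. uniform_limit {0..1} (\<lambda>i. (D01 ^^ m) (fn (f i))) ((D01 ^^ m) (fn l)) F"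
  have small: "\<forall>\<^sub>F i in F. hnorm n (f i - l) < e" if e: "e > 0" for n and e :: real
  proof -
    define K where "K = sqrt (2 * lam_zeta)"
    have K: "0 \<le> K" by (simp add: K_def lam_zeta_nonneg)
    obtain r where r: "0 < r" and Kr: "K * r < e"
      using exists_small_multiple[OF K e] .
    have "\<forall>\<^sub>F i in F. \<forall>x\<in>{0..1}. dist ((D01 ^^ (2 * (n + 1))) (fn (f i)) x) ((D01 ^^ (2 * (n + 1))) (fn l) x) < r"
      using u r unfolding uniform_limit_iff by blast
    then show ?thesis
    proof (rule eventually_mono)
      fix i assume i: "\<forall>x\<in>{0..1}. dist ((D01 ^^ (2 * (n + 1))) (fn (f i)) x) ((D01 ^^ (2 * (n + 1))) (fn l) x) < r"
      have "hnorm n (f i - l) \<le> K * r"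
        unfolding K_def
      proof (rule hnorm_le)
        fix x :: real assume x: "x \<in> {0..1}"
        show "\<bar>(D01 ^^ (2 * (n + 1))) (fn (f i - l)) x\<bar> \<le> r"
          unfolding D01_iter_fn_diff[OF x] using i x dist_real_def less_imp_le by metis
      qed
      then show "hnorm n (f i - l) < e" using Kr by simp
    qed
  qed
  show "(f \<longlongrightarrow> l) F"
  proof (rule topological_tendstoI)
    fix S assume "open S" "l \<in> S"
    then obtain M e where e: "e > 0" "\<And>v. (\<forall>n\<le>M. hnorm n (v - l) < e) \<Longrightarrow> v \<in> S"
      unfolding open_DAinf_def by blast
    have "\<forall>\<^sub>F i in F. \<forall>n\<in>{..M}. hnorm n (f i - l) < e"
      using small[OF e(1)] by (intro eventually_ball_finite) auto
    then show "\<forall>\<^sub>F i in F. f i \<in> S"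
      by (rule eventually_mono) (use e(2) in auto)
  qed
qed

lemma continuous_on_fn: "continuous_on UNIV (\<lambda>u. fn u x)"
proof (cases "x \<in> {0..1}")
  case True
  have "((\<lambda>u. fn u x) \<longlongrightarrow> fn u x) (at u)" for u
  proof (rule tendsto_uniform_limitI[OF _ True])
    have "((\<lambda>v. v) \<longlongrightarrow> u) (at u)" by (rule tendsto_ident_at)
    then show "uniform_limit {0..1} fn (fn u) (at u)"
      unfolding tendsto_DAinf_iff by (elim allE[of _ 0]) simp
  qed
  then show ?thesis by (simp add: continuous_on_def)
qed (simp add: fn_outside)

text \<open>Point evaluations are continuous and separate the elements. Uniqueness of limits makes
  \<open>differential\<close> a genuine value once a directional derivative is known.\<close>

instance DAinf :: t2_space
proof
  fix u v :: DAinf assume "u \<noteq> v"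
  then obtain x where "fn u x \<noteq> fn v x"
    using fn_inject by blast
  then obtain A B where "open A" "open B" "fn u x \<in> A" "fn v x \<in> B" "A \<inter> B = {}"
    by (rule hausdorff[THEN exE]) blast
  then show "\<exists>U V. open U \<and> open V \<and> u \<in> U \<and> v \<in> V \<and> U \<inter> V = {}"
    using open_vimage[OF _ continuous_on_fn, of A x] open_vimage[OF _ continuous_on_fn, of B x]
    by (intro exI[of _ "(\<lambda>u. fn u x) -` A"] exI[of _ "(\<lambda>u. fn u x) -` B"]) auto
qed

lemma D01_iter_fn_bounded: "bounded ((D01 ^^ m) (fn u) ` {0..1})"
  by (intro compact_imp_bounded compact_continuous_image smooth01_continuous fn_smooth01) simp

lemma uniform_limit_of_tendsto:
  "(c \<longlongrightarrow> c') F \<Longrightarrow> uniform_limit S (\<lambda>i x. c i) (\<lambda>x. c') F"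
  unfolding uniform_limit_iff by (auto dest: tendstoD elim: eventually_mono)

lemma tendsto_add_DAinf:
  fixes f g :: "'b \<Rightarrow> DAinf"
  assumes "(f \<longlongrightarrow> a) F" "(g \<longlongrightarrow> b) F"
  shows "((\<lambda>i. f i + g i) \<longlongrightarrow> a + b) F"
  unfolding tendsto_DAinf_iff
proof
  fix m
  have "uniform_limit {0..1} (\<lambda>i x. (D01 ^^ m) (fn (f i)) x + (D01 ^^ m) (fn (g i)) x)
      (\<lambda>x. (D01 ^^ m) (fn a) x + (D01 ^^ m) (fn b) x) F"
    using assms unfolding tendsto_DAinf_iff by (intro uniform_limit_add) auto
  then show "uniform_limit {0..1} (\<lambda>i. (D01 ^^ m) (fn (f i + g i))) ((D01 ^^ m) (fn (a + b))) F"
    by (rule uniform_limit_cong'[THEN iffD1, rotated 2]) (simp_all add: D01_iter_fn_add)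
qed

instance DAinf :: topological_monoid_add
  by standard (intro tendsto_add_DAinf filterlim_fst filterlim_snd)

lemma tendsto_scaleR_DAinf:
  fixes f :: "'b \<Rightarrow> DAinf"
  assumes "(c \<longlongrightarrow> c') F" "(f \<longlongrightarrow> a) F"
  shows "((\<lambda>i. c i *\<^sub>R f i) \<longlongrightarrow> c' *\<^sub>R a) F"
  unfolding tendsto_DAinf_iff
proof
  fix m
  have "uniform_limit {0..1} (\<lambda>i x. c i * (D01 ^^ m) (fn (f i)) x) (\<lambda>x. c' * (D01 ^^ m) (fn a) x) F"
    using assms(2) unfolding tendsto_DAinf_iff
    by (intro uniform_lim_mult uniform_limit_of_tendsto[OF assms(1)] D01_iter_fn_bounded)
       (auto simp: image_constant_conv)
  then show "uniform_limit {0..1} (\<lambda>i. (D01 ^^ m) (fn (c i *\<^sub>R f i))) ((D01 ^^ m) (fn (c' *\<^sub>R a))) F"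
    by (rule uniform_limit_cong'[THEN iffD1, rotated 2]) (simp_all add: D01_iter_fn_scaleR)
qed

section \<open>The operators \<open>u''\<close> and \<open>(u v)'\<close>\<close>

lift_definition Lap :: "DAinf \<Rightarrow> DAinf" is "\<lambda>f. (D01 ^^ 2) f"
proof -
  fix f assume f: "f \<in> DAinf_set"
  have "(D01 ^^ (2 * m)) ((D01 ^^ 2) f) = (D01 ^^ (2 * (m + 1))) f" for m
    by (simp add: D01_iter_D01_iter del: funpow.simps)
  then have "even_jets_vanish ((D01 ^^ 2) f)"
    using f unfolding DAinf_set_iff_smooth even_jets_vanish_def by metis
  then show "(D01 ^^ 2) f \<in> DAinf_set"
    using f smooth01_D01_iter[of f 2] D01_iter_outside[of f _ 2]
    unfolding DAinf_set_iff_smooth by blast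
qed

text \<open>It is the odd, not the even, derivatives of a product of two elements that vanish at the end
  points; the derivative of the product is therefore in the space again.\<close>

lift_definition dprod :: "DAinf \<Rightarrow> DAinf \<Rightarrow> DAinf" is "\<lambda>f g. D01 (\<lambda>x. f x * g x)"
proof -
  fix f g assume "f \<in> DAinf_set" "g \<in> DAinf_set"
  then have s: "smooth01 f" "smooth01 g" and ev: "even_jets_vanish f" "even_jets_vanish g"
    by (simp_all add: DAinf_set_iff_smooth)
  have fg: "smooth01 (\<lambda>x. f x * g x)"
    by (rule smooth01_mult[OF s])
  have "(D01 ^^ (2 * m)) (D01 (\<lambda>x. f x * g x)) x = 0" if x: "x = 0 \<or> x = 1" for m x
  proof -
    have "(D01 ^^ (2 * m)) (D01 (\<lambda>x. f x * g x)) x = (D01 ^^ (2 * m + 1)) (\<lambda>x. f x * g x) x"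
      by (simp add: funpow_swap1)
    also have "\<dots> = (\<Sum>i\<le>2 * m + 1. real ((2 * m + 1) choose i) *
        ((D01 ^^ i) f x * (D01 ^^ (2 * m + 1 - i)) g x))"
      using x by (intro D01_iter_mult[OF s]) auto
    also have "\<dots> = 0"
    proof (rule sum.neutral, rule ballI)
      fix i assume "i \<in> {..2 * m + 1}"
      \<comment> \<open>the two orders have an odd sum, so one of them is even\<close>
      then have "even i \<or> even (2 * m + 1 - i)" by auto
      then have "(D01 ^^ i) f x = 0 \<or> (D01 ^^ (2 * m + 1 - i)) g x = 0"
        using ev x unfolding even_jets_vanish_def by (metis evenE)
      then show "real ((2 * m + 1) choose i) * ((D01 ^^ i) f x * (D01 ^^ (2 * m + 1 - i)) g x) = 0"
        by auto
    qed
    finally show ?thesis .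
  qed
  then have "even_jets_vanish (D01 (\<lambda>x. f x * g x))"
    unfolding even_jets_vanish_def by blast
  then show "D01 (\<lambda>x. f x * g x) \<in> DAinf_set"
    using smooth01_D01_iter[OF fg, of 1] by (simp add: DAinf_set_iff_smooth) (simp add: D01_def)
qed

lemma fn_Lap_iter: "fn ((Lap ^^ n) u) = (D01 ^^ (2 * n)) (fn u)"
  by (induction n) (simp_all add: Lap.rep_eq numeral_2_eq_2)

lemma fn_dprod:
  "x \<in> {0..1} \<Longrightarrow> fn (dprod u v) x = D01 (fn u) x * fn v x + fn u x * D01 (fn v) x"
  using D01_iter_mult[OF fn_smooth01 fn_smooth01, of x 1 u v] by (simp add: dprod.rep_eq)

lemma DAinf_eqI: "(\<And>x. x \<in> {0..1} \<Longrightarrow> fn u x = fn v x) \<Longrightarrow> u = v"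
  by (metis fn_inject fn_outside ext)

lemma fn_add: "fn (u + v) x = fn u x + fn v x"
  and fn_scaleR: "fn (c *\<^sub>R u) x = c * fn u x"
  and fn_diff: "fn (u - v) x = fn u x - fn v x"
  by (simp_all add: plus_DAinf.rep_eq scaleR_DAinf.rep_eq minus_DAinf.rep_eq)

lemmas D01_fn =
  D01_iter_fn_add[of _ 1, simplified] D01_iter_fn_scaleR[of _ 1, simplified]
  D01_iter_fn_diff[of _ 1, simplified]

lemma Lap_scaleR: "Lap (c *\<^sub>R u) = c *\<^sub>R Lap u"
  by (rule DAinf_eqI) (simp only: Lap.rep_eq fn_scaleR D01_iter_fn_scaleR)

lemma Lap_diff: "Lap (u - v) = Lap u - Lap v"
  by (rule DAinf_eqI) (simp only: Lap.rep_eq fn_diff D01_iter_fn_diff)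

lemma Lap_zero: "Lap 0 = 0"
  using Lap_scaleR[of 0 0] by simp

lemma dprod_commute: "dprod u v = dprod v u"
  by (rule DAinf_eqI) (simp add: fn_dprod)

lemma dprod_scaleR_left: "dprod (c *\<^sub>R u) v = c *\<^sub>R dprod u v"
  by (rule DAinf_eqI) (simp add: fn_dprod fn_scaleR D01_fn algebra_simps)

lemma dprod_diff_left: "dprod (u - v) w = dprod u w - dprod v w"
  by (rule DAinf_eqI) (simp add: fn_dprod fn_diff D01_fn algebra_simps)

lemma dprod_scaleR_right: "dprod u (c *\<^sub>R v) = c *\<^sub>R dprod u v"
  by (simp add: dprod_commute[of u] dprod_scaleR_left)

lemma dprod_diff_right: "dprod w (u - v) = dprod w u - dprod w v"
  by (simp add: dprod_commute[of w] dprod_diff_left)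

lemma dprod_zero_left: "dprod 0 u = 0"
  using dprod_scaleR_left[of 0 0 u] by simp

lemma f0_fun_eq: "f0_fun (fn y) = fn (Lap y - (1 / 2) *\<^sub>R dprod y y)"
proof
  fix x
  show "f0_fun (fn y) x = fn (Lap y - (1 / 2) *\<^sub>R dprod y y) x"
  proof (cases "x \<in> {0..1}")
    case True
    then show ?thesis
      by (simp add: f0_fun_def fn_diff fn_scaleR fn_dprod Lap.rep_eq)
  next
    case False
    then show ?thesis
      by (auto simp: f0_fun_def fn_outside numeral_2_eq_2 D01_def)
  qed
qed

lemma f0_eq: "f0 y = Lap y - (1 / 2) *\<^sub>R dprod y y"
  by (simp add: f0_def f0_fun_eq fn_inverse)

lemma tendsto_Lap:
  assumes "(f \<longlongrightarrow> a) F"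
  shows "((\<lambda>i. Lap (f i)) \<longlongrightarrow> Lap a) F"
  using assms by (simp add: tendsto_DAinf_iff Lap.rep_eq D01_iter_D01_iter del: funpow.simps)

lemma uniform_limit_sum:
  fixes f :: "'i \<Rightarrow> 'a \<Rightarrow> 'b \<Rightarrow> 'c::real_normed_vector"
  assumes "\<And>k. k \<in> K \<Longrightarrow> uniform_limit X (f k) (l k) F"
  shows "uniform_limit X (\<lambda>i x. \<Sum>k\<in>K. f k i x) (\<lambda>x. \<Sum>k\<in>K. l k x) F"
  using assms by (induction K rule: infinite_finite_induct)
    (auto intro!: uniform_limit_add uniform_limit_const)

lemma tendsto_dprod:
  assumes f: "(f \<longlongrightarrow> a) F" and g: "(g \<longlongrightarrow> b) F"
  shows "((\<lambda>i. dprod (f i) (g i)) \<longlongrightarrow> dprod a b) F"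
  unfolding tendsto_DAinf_iff
proof
  fix m
  let ?S = "\<lambda>u v x. \<Sum>k\<le>Suc m. real (Suc m choose k) * ((D01 ^^ k) (fn u) x * (D01 ^^ (Suc m - k)) (fn v) x)"
  have S: "(D01 ^^ m) (fn (dprod u v)) x = ?S u v x" if "x \<in> {0..1}" for u v x
    using D01_iter_mult[OF fn_smooth01 fn_smooth01 that, of "Suc m" u v]
    by (simp only: dprod.rep_eq funpow_Suc_right comp_def)
  have "uniform_limit {0..1} (\<lambda>i x. (D01 ^^ k) (fn (f i)) x * (D01 ^^ j) (fn (g i)) x)
      (\<lambda>x. (D01 ^^ k) (fn a) x * (D01 ^^ j) (fn b) x) F" for k j
    using f g unfolding tendsto_DAinf_iff by (intro uniform_lim_mult D01_iter_fn_bounded) auto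
  then have "uniform_limit {0..1} (\<lambda>i. ?S (f i) (g i)) (?S a b) F"
    by (intro uniform_limit_sum bounded_linear.uniform_limit[OF bounded_linear_mult_right]) auto
  then show "uniform_limit {0..1} (\<lambda>i. (D01 ^^ m) (fn (dprod (f i) (g i)))) ((D01 ^^ m) (fn (dprod a b))) F"
    by (rule uniform_limit_cong'[THEN iffD1, rotated 2]) (simp_all only: S)
qed

section \<open>Directional derivatives of polynomial maps\<close>

lemma has_dir_derivative_imp_differential:
  fixes F :: "DAinf \<Rightarrow> DAinf"
  shows "has_dir_derivative F y h d \<Longrightarrow> differential F y h = d"
  unfolding differential_def has_dir_derivative_def
  by (rule the_equality) (auto intro: tendsto_unique[of "at (0::real)"])

text \<open>Multiplying the difference quotient by \<open>t\<close> recovers the increment of \<open>F\<close>.\<close>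

lemma tendsto_along_line:
  fixes F :: "DAinf \<Rightarrow> DAinf"
  assumes "has_dir_derivative F y h d"
  shows "((\<lambda>t. F (y + t *\<^sub>R h)) \<longlongrightarrow> F y) (at 0)"
proof -
  have "((\<lambda>t. F y + t *\<^sub>R ((F (y + t *\<^sub>R h) - F y) /\<^sub>R t)) \<longlongrightarrow> F y + 0 *\<^sub>R d) (at 0)"
    using assms unfolding has_dir_derivative_def
    by (intro tendsto_add tendsto_const tendsto_scaleR_DAinf tendsto_ident_at)
  moreover have "F y + t *\<^sub>R ((F (y + t *\<^sub>R h) - F y) /\<^sub>R t) = F (y + t *\<^sub>R h)" for t
    by (cases "t = 0") auto
  ultimately show ?thesis by simp
qed

lemma has_dir_derivative_const: "has_dir_derivative (\<lambda>y::DAinf. c) y h 0"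
  by (simp add: has_dir_derivative_def)

lemma has_dir_derivative_id: "has_dir_derivative (\<lambda>y::DAinf. y) y h h"
  unfolding has_dir_derivative_def
  by (rule tendsto_eventually) (auto simp: eventually_at_filter)

lemma has_dir_derivative_add:
  fixes F G :: "DAinf \<Rightarrow> DAinf"
  assumes "has_dir_derivative F y h d" "has_dir_derivative G y h e"
  shows "has_dir_derivative (\<lambda>y. F y + G y) y h (d + e)"
  using tendsto_add[OF assms[unfolded has_dir_derivative_def]]
  by (simp add: has_dir_derivative_def scaleR_add_right[symmetric] add_diff_add)

lemma has_dir_derivative_scaleR:
  fixes F :: "DAinf \<Rightarrow> DAinf"
  assumes "has_dir_derivative F y h d"
  shows "has_dir_derivative (\<lambda>y. c *\<^sub>R F y) y h (c *\<^sub>R d)"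
  using tendsto_scaleR_DAinf[OF tendsto_const assms[unfolded has_dir_derivative_def], of c]
  by (simp add: has_dir_derivative_def scaleR_diff_right[symmetric] mult.commute)

lemma has_dir_derivative_Lap:
  assumes "has_dir_derivative F y h d"
  shows "has_dir_derivative (\<lambda>y. Lap (F y)) y h (Lap d)"
  using tendsto_Lap[OF assms[unfolded has_dir_derivative_def]]
  by (simp add: has_dir_derivative_def Lap_scaleR Lap_diff)

text \<open>The difference quotient of the product splits into one quotient paired with the moved value
  of \<open>G\<close> and the other paired with the fixed value of \<open>F\<close>.\<close>

lemma has_dir_derivative_dprod:
  assumes F: "has_dir_derivative F y h d" and G: "has_dir_derivative G y h e"
  shows "has_dir_derivative (\<lambda>y. dprod (F y) (G y)) y h (dprod d (G y) + dprod (F y) e)"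
proof -
  let ?q = "\<lambda>F t. (F (y + t *\<^sub>R h) - F y) /\<^sub>R t"
  have "((\<lambda>t. dprod (?q F t) (G (y + t *\<^sub>R h)) + dprod (F y) (?q G t)) \<longlongrightarrow> dprod d (G y) + dprod (F y) e) (at 0)"
    using F G tendsto_along_line[OF G] unfolding has_dir_derivative_def
    by (intro tendsto_add tendsto_dprod tendsto_const)
  moreover have "dprod (?q F t) (G (y + t *\<^sub>R h)) + dprod (F y) (?q G t) = ?q (\<lambda>y. dprod (F y) (G y)) t" for t
    by (simp add: dprod_scaleR_left dprod_scaleR_right dprod_diff_left dprod_diff_right scaleR_add_right[symmetric])
  ultimately show ?thesis by (simp add: has_dir_derivative_def)
qed

text \<open>Maps that are polynomial in \<open>y\<close> and its derivatives, built only from operations that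
  preserve the boundary conditions. The class contains \<open>f0\<close> and is closed under
  \<open>y \<mapsto> dF(y)(G(y))\<close>, hence under Lie brackets.\<close>

inductive diff_poly :: "(DAinf \<Rightarrow> DAinf) \<Rightarrow> bool" where
  const: "diff_poly (\<lambda>y. c)"
| id: "diff_poly (\<lambda>y. y)"
| add: "diff_poly F \<Longrightarrow> diff_poly G \<Longrightarrow> diff_poly (\<lambda>y. F y + G y)"
| scaleR: "diff_poly F \<Longrightarrow> diff_poly (\<lambda>y. c *\<^sub>R F y)"
| Lap: "diff_poly F \<Longrightarrow> diff_poly (\<lambda>y. Lap (F y))"
| dprod: "diff_poly F \<Longrightarrow> diff_poly G \<Longrightarrow> diff_poly (\<lambda>y. dprod (F y) (G y))"

lemma diff_poly_diff: "diff_poly F \<Longrightarrow> diff_poly G \<Longrightarrow> diff_poly (\<lambda>y. F y - G y)"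
  using diff_poly.add[OF _ diff_poly.scaleR[of G "- 1"]] by simp

lemma diff_poly_f0: "diff_poly f0"
  unfolding f0_eq[abs_def] by (intro diff_poly_diff diff_poly.intros)

lemma continuous_on_scaleR_DAinf:
  fixes f :: "'b::topological_space \<Rightarrow> DAinf"
  shows "continuous_on S f \<Longrightarrow> continuous_on S (\<lambda>x. c *\<^sub>R f x)"
  unfolding continuous_on_def by (auto intro: tendsto_scaleR_DAinf[OF tendsto_const])

lemma continuous_on_Lap: "continuous_on S f \<Longrightarrow> continuous_on S (\<lambda>x. Lap (f x))"
  unfolding continuous_on_def by (blast intro: tendsto_Lap)

lemma continuous_on_dprod:
  "continuous_on S f \<Longrightarrow> continuous_on S g \<Longrightarrow> continuous_on S (\<lambda>x. dprod (f x) (g x))"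
  unfolding continuous_on_def by (blast intro: tendsto_dprod)

lemma continuous_on_diff_poly: "diff_poly F \<Longrightarrow> continuous_on UNIV F"
  by (induction rule: diff_poly.induct)
    (auto intro: continuous_on_const continuous_on_id continuous_on_add
      continuous_on_scaleR_DAinf continuous_on_Lap continuous_on_dprod)

text \<open>The derivative is a map of two arguments and so outside the class; what iterated brackets
  need is that substituting a member of the class for the direction leads back into it.
  Joint continuity gives \<open>C\<^sup>1\<close>, and together with homogeneity in the direction it allows
  derivatives to be differentiated once more at the origin.\<close>

lemma diff_poly_has_derivative:
  assumes "diff_poly F"
  shows "\<exists>dF. (\<forall>y h. has_dir_derivative F y h (dF y h)) \<and>
    continuous_on UNIV (\<lambda>p. dF (fst p) (snd p)) \<and>
    (\<forall>y c h. dF y (c *\<^sub>R h) = c *\<^sub>R dF y h) \<and>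
    (\<forall>G. diff_poly G \<longrightarrow> diff_poly (\<lambda>y. dF y (G y)))"
  using assms
proof (induction rule: diff_poly.induct)
  case (const c)
  show ?case
    by (intro exI[of _ "\<lambda>y h. 0"])
       (auto intro: has_dir_derivative_const diff_poly.const)
next
  case id
  show ?case
    by (intro exI[of _ "\<lambda>y h. h"])
       (auto intro: has_dir_derivative_id continuous_on_snd continuous_on_id)
next
  case (add F G)
  then obtain dF dG where
    "\<forall>y h. has_dir_derivative F y h (dF y h)" "continuous_on UNIV (\<lambda>p. dF (fst p) (snd p))"
    "\<forall>y c h. dF y (c *\<^sub>R h) = c *\<^sub>R dF y h" "\<forall>G. diff_poly G \<longrightarrow> diff_poly (\<lambda>y. dF y (G y))"
    "\<forall>y h. has_dir_derivative G y h (dG y h)" "continuous_on UNIV (\<lambda>p. dG (fst p) (snd p))"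
    "\<forall>y c h. dG y (c *\<^sub>R h) = c *\<^sub>R dG y h" "\<forall>F. diff_poly F \<longrightarrow> diff_poly (\<lambda>y. dG y (F y))"
    by blast
  then show ?case
    by (intro exI[of _ "\<lambda>y h. dF y h + dG y h"])
       (auto intro: has_dir_derivative_add continuous_on_add diff_poly.add simp: scaleR_add_right)
next
  case (scaleR F c)
  then obtain dF where
    "\<forall>y h. has_dir_derivative F y h (dF y h)" "continuous_on UNIV (\<lambda>p. dF (fst p) (snd p))"
    "\<forall>y c h. dF y (c *\<^sub>R h) = c *\<^sub>R dF y h" "\<forall>G. diff_poly G \<longrightarrow> diff_poly (\<lambda>y. dF y (G y))"
    by blast
  then show ?case
    by (intro exI[of _ "\<lambda>y h. c *\<^sub>R dF y h"])
       (auto intro: has_dir_derivative_scaleR continuous_on_scaleR_DAinf diff_poly.scaleR simp: mult.commute)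
next
  case (Lap F)
  then obtain dF where
    "\<forall>y h. has_dir_derivative F y h (dF y h)" "continuous_on UNIV (\<lambda>p. dF (fst p) (snd p))"
    "\<forall>y c h. dF y (c *\<^sub>R h) = c *\<^sub>R dF y h" "\<forall>G. diff_poly G \<longrightarrow> diff_poly (\<lambda>y. dF y (G y))"
    by blast
  then show ?case
    by (intro exI[of _ "\<lambda>y h. Lap (dF y h)"])
       (auto intro: has_dir_derivative_Lap continuous_on_Lap diff_poly.Lap simp: Lap_scaleR)
next
  case (dprod F G)
  then obtain dF dG where
    d: "\<forall>y h. has_dir_derivative F y h (dF y h)" "continuous_on UNIV (\<lambda>p. dF (fst p) (snd p))"
    "\<forall>y c h. dF y (c *\<^sub>R h) = c *\<^sub>R dF y h" "\<forall>G. diff_poly G \<longrightarrow> diff_poly (\<lambda>y. dF y (G y))"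
    "\<forall>y h. has_dir_derivative G y h (dG y h)" "continuous_on UNIV (\<lambda>p. dG (fst p) (snd p))"
    "\<forall>y c h. dG y (c *\<^sub>R h) = c *\<^sub>R dG y h" "\<forall>F. diff_poly F \<longrightarrow> diff_poly (\<lambda>y. dG y (F y))"
    by blast
  have "continuous_on UNIV (\<lambda>p::DAinf \<times> DAinf. H (fst p))" if "diff_poly H" for H
    by (rule continuous_on_compose2[OF continuous_on_diff_poly[OF that]])
       (auto intro: continuous_on_fst continuous_on_id)
  with dprod.hyps d show ?case
    by (intro exI[of _ "\<lambda>y h. dprod (dF y h) (G y) + dprod (F y) (dG y h)"])
       (auto intro!: has_dir_derivative_dprod continuous_on_add continuous_on_dprod diff_poly.add diff_poly.dprod
             simp: scaleR_add_right dprod_scaleR_left dprod_scaleR_right)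
qed

lemma
  assumes "diff_poly F"
  shows diff_poly_has_differential: "has_dir_derivative F y h (differential F y h)"
    and diff_poly_continuous_differential: "continuous_on UNIV (\<lambda>p. differential F (fst p) (snd p))"
    and diff_poly_differential_scaleR: "differential F y (c *\<^sub>R h) = c *\<^sub>R differential F y h"
    and diff_poly_differential: "diff_poly G \<Longrightarrow> diff_poly (\<lambda>y. differential F y (G y))"
proof -
  obtain dF where dF: "\<And>y h. has_dir_derivative F y h (dF y h)"
    "continuous_on UNIV (\<lambda>p. dF (fst p) (snd p))"
    "\<And>y c h. dF y (c *\<^sub>R h) = c *\<^sub>R dF y h"
    "\<And>G. diff_poly G \<Longrightarrow> diff_poly (\<lambda>y. dF y (G y))"
    using diff_poly_has_derivative[OF assms] by blast
  have "differential F = dF"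
    using has_dir_derivative_imp_differential[OF dF(1)] by (intro ext)
  with dF show "has_dir_derivative F y h (differential F y h)"
    "continuous_on UNIV (\<lambda>p. differential F (fst p) (snd p))"
    "differential F y (c *\<^sub>R h) = c *\<^sub>R differential F y h"
    "diff_poly G \<Longrightarrow> diff_poly (\<lambda>y. differential F y (G y))"
    by simp_all
qed

lemma C1_map_diff_poly: "diff_poly F \<Longrightarrow> C1_map F"
  unfolding C1_map_def split_beta
  using diff_poly_has_differential diff_poly_continuous_differential by blast

lemma differential_zero_right: "diff_poly F \<Longrightarrow> differential F y 0 = 0"
  using diff_poly_differential_scaleR[of F y 0 0] by simp

text \<open>A second derivative of \<open>F\<close> would enter only in the direction \<open>G 0 = 0\<close>. Accordingly none
  is needed: by homogeneity the difference quotient is \<open>dF(t h)(G(t h) / t)\<close>, which converges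
  by joint continuity of \<open>dF\<close>.\<close>

lemma has_dir_derivative_differential_at_zero:
  assumes F: "diff_poly F" and G: "has_dir_derivative G 0 h d" and G0: "G 0 = 0"
  shows "has_dir_derivative (\<lambda>y. differential F y (G y)) 0 h (differential F 0 d)"
proof -
  let ?q = "\<lambda>t. (G (0 + t *\<^sub>R h) - G 0) /\<^sub>R t"
  have "((\<lambda>t. t *\<^sub>R h) \<longlongrightarrow> 0 *\<^sub>R h) (at 0)"
    by (intro tendsto_scaleR_DAinf tendsto_ident_at tendsto_const)
  then have "((\<lambda>t. (t *\<^sub>R h, ?q t)) \<longlongrightarrow> (0, d)) (at 0)"
    using G unfolding has_dir_derivative_def by (intro tendsto_Pair) simp_all
  from continuous_on_tendsto_compose[OF diff_poly_continuous_differential[OF F] this]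
  have "((\<lambda>t. differential F (t *\<^sub>R h) (?q t)) \<longlongrightarrow> differential F 0 d) (at 0)"
    by simp
  then show ?thesis
    by (simp add: has_dir_derivative_def G0 diff_poly_differential_scaleR[OF F] differential_zero_right[OF F])
qed

lemma differential_f0: "differential f0 y h = Lap h - dprod y h"
proof (rule has_dir_derivative_imp_differential)
  have "has_dir_derivative (\<lambda>y. Lap y + (- 1 / 2) *\<^sub>R dprod y y) y h
      (Lap h + (- 1 / 2) *\<^sub>R (dprod h y + dprod y h))"
    by (intro has_dir_derivative_add has_dir_derivative_Lap has_dir_derivative_scaleR
          has_dir_derivative_dprod has_dir_derivative_id)
  moreover have "Lap h + (- 1 / 2) *\<^sub>R (dprod h y + dprod y h) = Lap h - dprod y h"
    by (simp add: dprod_commute[of h] scaleR_2[symmetric])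
  ultimately show "has_dir_derivative f0 y h (Lap h - dprod y h)"
    by (simp add: f0_eq[abs_def])
qed

section \<open>The iterated brackets at the origin\<close>

context
  fixes mu :: DAinf
begin

abbreviation ad_f0 :: "nat \<Rightarrow> DAinf \<Rightarrow> DAinf" where
  "ad_f0 n \<equiv> ad_iter f0 n (\<lambda>_. mu)"

lemma ad_f0_Suc: "ad_f0 (Suc n) y = differential (ad_f0 n) y (f0 y) - Lap (ad_f0 n y) + dprod y (ad_f0 n y)"
  by (simp add: lie_bracket_def differential_f0)

lemma diff_poly_ad_f0: "diff_poly (ad_f0 n)"
proof (induction n)
  case (Suc n)
  have "ad_f0 (Suc n) = (\<lambda>y. differential (ad_f0 n) y (f0 y) - Lap (ad_f0 n y) + dprod y (ad_f0 n y))"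
    using ad_f0_Suc by blast
  then show ?case
    using Suc by (auto intro!: diff_poly.intros diff_poly_diff diff_poly_differential diff_poly_f0)
qed (simp add: diff_poly.const)

lemma f0_zero: "f0 0 = 0"
  by (simp add: f0_eq Lap_zero dprod_zero_left)

text \<open>At the origin \<open>f0\<close> and \<open>dprod\<close> contribute nothing, and each bracket adds one \<open>- Lap\<close>.\<close>

lemma ad_f0_zero: "ad_f0 n 0 = (- 1) ^ n *\<^sub>R (Lap ^^ n) mu"
proof (induction n)
  case (Suc n)
  have "ad_f0 (Suc n) 0 = - Lap (ad_f0 n 0)"
    by (simp only: ad_f0_Suc f0_zero differential_zero_right[OF diff_poly_ad_f0] dprod_zero_left) simp
  then show ?case by (simp only: Suc) (simp add: Lap_scaleR)
qed simp

text \<open>Linearisation of \<open>ad_f0_Suc\<close> at the origin, where \<open>f0\<close> vanishes and has the linear part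
  \<open>Lap\<close>; the product rule for \<open>dprod\<close> leaves only the term that differentiates \<open>y\<close>.\<close>

lemma differential_ad_f0_Suc_zero:
  "differential (ad_f0 (Suc n)) 0 h =
     differential (ad_f0 n) 0 (Lap h) - Lap (differential (ad_f0 n) 0 h) + (- 1) ^ n *\<^sub>R dprod h ((Lap ^^ n) mu)"
proof -
  note ad' = diff_poly_has_differential[OF diff_poly_ad_f0, of n 0 h]
  have "has_dir_derivative f0 0 h (Lap h)"
    using diff_poly_has_differential[OF diff_poly_f0, of 0 h] by (simp add: differential_f0 dprod_zero_left)
  then have "has_dir_derivative (\<lambda>y. differential (ad_f0 n) y (f0 y)) 0 h (differential (ad_f0 n) 0 (Lap h))"
    by (intro has_dir_derivative_differential_at_zero diff_poly_ad_f0 f0_zero)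
  from has_dir_derivative_add[OF has_dir_derivative_add[OF this
        has_dir_derivative_scaleR[OF has_dir_derivative_Lap[OF ad'], of "- 1"]]
        has_dir_derivative_dprod[OF has_dir_derivative_id ad']]
  have "has_dir_derivative (ad_f0 (Suc n)) 0 h
      (differential (ad_f0 n) 0 (Lap h) - Lap (differential (ad_f0 n) 0 h) + dprod h (ad_f0 n 0))"
    by (simp add: ad_f0_Suc[abs_def] dprod_zero_left del: ad_iter.simps)
  then show ?thesis
    by (simp only: has_dir_derivative_imp_differential ad_f0_zero dprod_scaleR_right)
qed

end

section \<open>Pairing with a sine mode\<close>

lemma ip_fn_add: "ip (fn (u + v)) (phi k) = ip (fn u) (phi k) + ip (fn v) (phi k)"
  unfolding plus_DAinf.rep_eq by (intro ip_add_left fn_continuous continuous_on_phi)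

lemma ip_fn_diff: "ip (fn (u - v)) (phi k) = ip (fn u) (phi k) - ip (fn v) (phi k)"
  unfolding minus_DAinf.rep_eq by (intro ip_diff_left fn_continuous continuous_on_phi)

lemma ip_fn_scaleR: "ip (fn (c *\<^sub>R u)) g = c * ip (fn u) g"
  unfolding scaleR_DAinf.rep_eq by (rule ip_cmult_left)

lemma ip_fn_Lap: "ip (fn (Lap u)) (phi k) = - lam k * ip (fn u) (phi k)"
  using ip_even_derivative_phi[OF fn_smooth01 fn_even_jets_vanish, where m = 1] by (simp add: Lap.rep_eq)

lemma ip_fn_dprod: "ip (fn (dprod u v)) (phi k) = - ip (\<lambda>x. fn u x * fn v x) (deriv (phi k))"
  unfolding dprod.rep_eq by (rule ip_D01_phi[OF smooth01_mult[OF fn_smooth01 fn_smooth01]])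

context
  fixes mu :: DAinf and k :: nat
begin

text \<open>The pairing that remains of \<open>dprod\<close> after integration by parts against \<open>phi k\<close>.\<close>

definition pair :: "DAinf \<Rightarrow> DAinf \<Rightarrow> real" where
  "pair u v = ip (\<lambda>x. fn u x * fn v x) (deriv (phi k))"

lemma ip_differential_ad_f0_Suc:
  "ip (fn (differential (ad_f0 mu (Suc n)) 0 h)) (phi k) =
     ip (fn (differential (ad_f0 mu n) 0 (Lap h))) (phi k) + lam k * ip (fn (differential (ad_f0 mu n) 0 h)) (phi k)
     - (- 1) ^ n * pair ((Lap ^^ n) mu) h"
  unfolding differential_ad_f0_Suc_zero ip_fn_add ip_fn_diff ip_fn_scaleR ip_fn_Lap
  by (simp add: dprod_commute[of h] ip_fn_dprod pair_def)

text \<open>Against \<open>phi k\<close>, the linear part of the bracket of order \<open>n + 1\<close> at \<open>h\<close> is the one of order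
  \<open>n\<close> at \<open>Lap h + lam k h\<close>, plus, up to sign, a new pairing of \<open>h\<close> with the \<open>n\<close>-th iterate
  of \<open>mu\<close>. The pairing created at step \<open>\<beta>\<close> thus has \<open>(Lap + lam k)\<^bsup>n-1-\<beta>\<^esup> h\<close> as its other argument, and the
  binomial theorem gives the formula.\<close>

lemma ip_differential_ad_f0:
  "ip (fn (differential (ad_f0 mu n) 0 h)) (phi k) =
     - (\<Sum>\<beta><n. (- 1) ^ \<beta> * (\<Sum>\<alpha>\<le>n - 1 - \<beta>. real ((n - 1 - \<beta>) choose \<alpha>) *
          (pair ((Lap ^^ \<beta>) mu) ((Lap ^^ \<alpha>) h) * lam k ^ (n - 1 - \<beta> - \<alpha>))))"
proof (induction n arbitrary: h)
  case 0
  have "differential (\<lambda>_. mu) 0 h = 0"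
    by (intro has_dir_derivative_imp_differential has_dir_derivative_const)
  then show ?case
    using ip_fn_scaleR[of 0 0 "phi k"] by simp
next
  case (Suc n)
  let ?T = "\<lambda>\<beta> m h. \<Sum>\<alpha>\<le>m. real (m choose \<alpha>) * (pair ((Lap ^^ \<beta>) mu) ((Lap ^^ \<alpha>) h) * lam k ^ (m - \<alpha>))"
  have T: "?T \<beta> (Suc m) h = ?T \<beta> m (Lap h) + lam k * ?T \<beta> m h" for \<beta> m h
    unfolding leibniz_sum_Suc[of m "\<lambda>\<alpha>. pair ((Lap ^^ \<beta>) mu) ((Lap ^^ \<alpha>) h)" "\<lambda>j. lam k ^ j", symmetric]
    by (simp add: funpow_swap1 sum_distrib_left sum.distrib[symmetric] algebra_simps)
  have S: "(\<Sum>\<beta><n. (- 1) ^ \<beta> * ?T \<beta> (n - \<beta>) h)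
      = (\<Sum>\<beta><n. (- 1) ^ \<beta> * ?T \<beta> (n - 1 - \<beta>) (Lap h)) + lam k * (\<Sum>\<beta><n. (- 1) ^ \<beta> * ?T \<beta> (n - 1 - \<beta>) h)"
  proof -
    have "(- 1) ^ \<beta> * ?T \<beta> (n - \<beta>) h
        = (- 1) ^ \<beta> * ?T \<beta> (n - 1 - \<beta>) (Lap h) + lam k * ((- 1) ^ \<beta> * ?T \<beta> (n - 1 - \<beta>) h)"
      if "\<beta> < n" for \<beta>
    proof -
      have "n - \<beta> = Suc (n - 1 - \<beta>)" using that by auto
      then show ?thesis
        by (simp only: T distrib_left mult.left_commute[of "lam k"])
    qed
    then have "(\<Sum>\<beta><n. (- 1) ^ \<beta> * ?T \<beta> (n - \<beta>) h)
        = (\<Sum>\<beta><n. (- 1) ^ \<beta> * ?T \<beta> (n - 1 - \<beta>) (Lap h) + lam k * ((- 1) ^ \<beta> * ?T \<beta> (n - 1 - \<beta>) h))"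
      by (intro sum.cong) auto
    then show ?thesis
      by (simp only: sum.distrib sum_distrib_left[symmetric])
  qed
  have "ip (fn (differential (ad_f0 mu (Suc n)) 0 h)) (phi k)
      = - (\<Sum>\<beta><n. (- 1) ^ \<beta> * ?T \<beta> (n - \<beta>) h) - (- 1) ^ n * ?T n 0 h"
  proof -
    have "?T n 0 h = pair ((Lap ^^ n) mu) h" by simp
    then show ?thesis
      unfolding ip_differential_ad_f0_Suc Suc.IH[of "Lap h"] Suc.IH[of h] S
      by (simp only: minus_add_distrib mult_minus_right)
  qed
  also have "\<dots> = - (\<Sum>\<beta><Suc n. (- 1) ^ \<beta> * ?T \<beta> (n - \<beta>) h)"
    unfolding sum.lessThan_Suc by (simp only: minus_add_distrib diff_conv_add_uminus diff_self_eq_0)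
  finally show ?case by (simp only: diff_Suc_1)
qed

text \<open>The two binomial coefficients in the definition of Lucas's triangle separate a sum into a
  binomial sum of order \<open>m\<close> and one of order \<open>m - 1\<close> with \<open>a\<close> shifted by one.\<close>

lemma lucas_triangle_sum:
  fixes a b :: "nat \<Rightarrow> real"
  shows "(\<Sum>\<alpha>\<le>m. real (lucas_triangle m \<alpha>) * (a \<alpha> * b (m - \<alpha>))) =
    (\<Sum>\<alpha>\<le>m. real (m choose \<alpha>) * (a \<alpha> * b (m - \<alpha>))) +
    (if m = 0 then 0 else \<Sum>\<alpha>\<le>m - 1. real ((m - 1) choose \<alpha>) * (a (Suc \<alpha>) * b (m - 1 - \<alpha>)))"
proof (cases m)
  case (Suc l)
  show ?thesis
    unfolding Suc by (subst (1 2) sum.atMost_Suc_shift)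
      (simp add: lucas_triangle_def distrib_left distrib_right sum.distrib sum_distrib_left mult.assoc)
qed (simp add: lucas_triangle_def)

text \<open>The signs of the values at the origin turn the difference in the Lie bracket into a sum of
  the linear part of order \<open>n + 1\<close> at the \<open>n\<close>-th iterate and that of order \<open>n\<close> at the
  \<open>n + 1\<close>-st. The extra iterate in the second is the shift by which Lucas's triangle arises.\<close>

lemma ip_bracket_eq_lucas_sum:
  "ip (fn (lie_bracket (ad_f0 mu n) (ad_f0 mu (Suc n)) 0)) (phi k) =
    (\<Sum>\<beta>\<le>n. (- 1) ^ (Suc n + \<beta>) * (\<Sum>\<alpha>\<le>n - \<beta>. real (lucas_triangle (n - \<beta>) \<alpha>) *
        (pair ((Lap ^^ \<beta>) mu) ((Lap ^^ (n + \<alpha>)) mu) * lam k ^ (n - \<beta> - \<alpha>))))"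
proof -
  let ?p = "\<lambda>\<beta> \<alpha>. pair ((Lap ^^ \<beta>) mu) ((Lap ^^ (n + \<alpha>)) mu)"
  let ?u = "\<lambda>\<beta>. \<Sum>\<alpha>\<le>n - \<beta>. real ((n - \<beta>) choose \<alpha>) * (?p \<beta> \<alpha> * lam k ^ (n - \<beta> - \<alpha>))"
  let ?v = "\<lambda>\<beta>. \<Sum>\<alpha>\<le>n - \<beta> - 1. real ((n - \<beta> - 1) choose \<alpha>) * (?p \<beta> (Suc \<alpha>) * lam k ^ (n - \<beta> - 1 - \<alpha>))"
  have 1: "ip (fn (differential (ad_f0 mu (Suc n)) 0 ((Lap ^^ n) mu))) (phi k) = - (\<Sum>\<beta>\<le>n. (- 1) ^ \<beta> * ?u \<beta>)"
  proof -
    have "(Lap ^^ \<alpha>) ((Lap ^^ n) mu) = (Lap ^^ (n + \<alpha>)) mu" for \<alpha>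
      using funpow_add[of \<alpha> n Lap] by (simp add: add.commute)
    then show ?thesis
      by (simp only: ip_differential_ad_f0 lessThan_Suc_atMost diff_Suc_1)
  qed
  have 2: "ip (fn (differential (ad_f0 mu n) 0 ((Lap ^^ Suc n) mu))) (phi k) = - (\<Sum>\<beta><n. (- 1) ^ \<beta> * ?v \<beta>)"
  proof -
    have "(Lap ^^ \<alpha>) ((Lap ^^ Suc n) mu) = (Lap ^^ (n + Suc \<alpha>)) mu" for \<alpha>
      using funpow_add[of \<alpha> "Suc n" Lap] by (simp add: add.commute del: funpow.simps)
    then show ?thesis
      by (simp only: ip_differential_ad_f0 diff_commute[of n 1])
  qed
  have signs: "(- 1) ^ Suc n * ((\<Sum>\<beta>\<le>n. (- 1) ^ \<beta> * u \<beta>) + (\<Sum>\<beta>\<le>n. (- 1) ^ \<beta> * v \<beta>))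
      = (\<Sum>\<beta>\<le>n. (- 1) ^ (Suc n + \<beta>) * (u \<beta> + v \<beta>))" for u v :: "nat \<Rightarrow> real"
    by (simp only: sum.distrib[symmetric] sum_distrib_left distrib_left power_add mult.assoc)
  have "lie_bracket (ad_f0 mu n) (ad_f0 mu (Suc n)) 0 = (- 1) ^ n *\<^sub>R
      (differential (ad_f0 mu (Suc n)) 0 ((Lap ^^ n) mu) + differential (ad_f0 mu n) 0 ((Lap ^^ Suc n) mu))"
    unfolding lie_bracket_def ad_f0_zero diff_poly_differential_scaleR[OF diff_poly_ad_f0]
    by (simp add: scaleR_add_right del: ad_iter.simps funpow.simps)
  then have "ip (fn (lie_bracket (ad_f0 mu n) (ad_f0 mu (Suc n)) 0)) (phi k)
      = (- 1) ^ Suc n * ((\<Sum>\<beta>\<le>n. (- 1) ^ \<beta> * ?u \<beta>) + (\<Sum>\<beta><n. (- 1) ^ \<beta> * ?v \<beta>))"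
    by (simp only: ip_fn_scaleR ip_fn_add 1 2 power_Suc minus_add_distrib[symmetric]
        mult_minus_left mult_minus_right mult_1_left)
  also have "(\<Sum>\<beta><n. (- 1) ^ \<beta> * ?v \<beta>) = (\<Sum>\<beta>\<le>n. (- 1) ^ \<beta> * (if n - \<beta> = 0 then 0 else ?v \<beta>))"
    unfolding lessThan_Suc_atMost[symmetric] sum.lessThan_Suc by simp
  also have "(- 1) ^ Suc n * ((\<Sum>\<beta>\<le>n. (- 1) ^ \<beta> * ?u \<beta>) + \<dots>)
      = (\<Sum>\<beta>\<le>n. (- 1) ^ (Suc n + \<beta>) * (?u \<beta> + (if n - \<beta> = 0 then 0 else ?v \<beta>)))"
    by (rule signs)
  also have "\<dots> = (\<Sum>\<beta>\<le>n. (- 1) ^ (Suc n + \<beta>) * (\<Sum>\<alpha>\<le>n - \<beta>. real (lucas_triangle (n - \<beta>) \<alpha>) *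
        (?p \<beta> \<alpha> * lam k ^ (n - \<beta> - \<alpha>))))"
    by (simp only: lucas_triangle_sum[of "n - \<beta>" "?p \<beta>" "\<lambda>j. lam k ^ j" for \<beta>])
  finally show ?thesis .
qed

lemma sum_triangle_swap:
  fixes g :: "nat \<Rightarrow> nat \<Rightarrow> real"
  shows "(\<Sum>\<alpha>\<le>n. \<Sum>\<beta>\<le>n - \<alpha>. g \<alpha> \<beta>) = (\<Sum>\<beta>\<le>n. \<Sum>\<alpha>\<le>n - \<beta>. g \<alpha> \<beta>)"
proof -
  have "{..n - \<alpha>} = {\<beta> \<in> {..n}. \<alpha> + \<beta> \<le> n}" if "\<alpha> \<le> n" for \<alpha>
    using that by auto
  moreover have "{..n - \<beta>} = {\<alpha> \<in> {..n}. \<alpha> + \<beta> \<le> n}" if "\<beta> \<le> n" for \<beta>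
    using that by auto
  ultimately show ?thesis
    using sum.swap_restrict[of "{..n}" "{..n}" g "\<lambda>\<alpha> \<beta>. \<alpha> + \<beta> \<le> n"] by simp
qed

lemma a_coeff_eq_bracket:
  "a_coeff k (Suc n) (fn mu) = - (1/2) * ip (fn (lie_bracket (ad_f0 mu n) (ad_f0 mu (Suc n)) 0)) (phi k)"
proof -
  have "a_coeff k (Suc n) (fn mu) = - (1/2) * (\<Sum>\<alpha>\<le>n. \<Sum>\<beta>\<le>n - \<alpha>.
      (- 1) ^ (Suc n + \<beta>) * real (lucas_triangle (n - \<beta>) \<alpha>) * lam k ^ (n - \<alpha> - \<beta>) *
      pair ((Lap ^^ \<beta>) mu) ((Lap ^^ (n + \<alpha>)) mu))"
    by (simp add: a_coeff_def pair_def fn_Lap_iter atLeast0AtMost del: funpow.simps)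
  also have "\<dots> = - (1/2) * ip (fn (lie_bracket (ad_f0 mu n) (ad_f0 mu (Suc n)) 0)) (phi k)"
    unfolding ip_bracket_eq_lucas_sum sum_distrib_left
    by (subst sum_triangle_swap) (intro sum.cong refl, simp only: diff_commute mult_ac)
  finally show ?thesis .
qed

end

theorem proposition3p2:
  fixes mu :: DAinf and k :: nat
    and f1 :: "DAinf \<Rightarrow> DAinf" and M W :: "nat \<Rightarrow> DAinf \<Rightarrow> DAinf"
  assumes "k \<ge> 1"
    and "\<And>y. f1 y = mu"
    and "\<And>n. M n = ad_iter f0 n f1"
    and "\<And>N. N \<ge> 1 \<Longrightarrow> W N = lie_bracket (M (N - 1)) (M N)"
  shows "(\<forall>y. fn (f0 y) = f0_fun (fn y)) \<and> C1_map f0 \<and> (\<forall>n. C1_map (M n)) \<and>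
         (\<forall>N\<ge>1. a_coeff k N (fn mu) = - (1/2) * ip (fn (W N 0)) (phi k))"
proof (intro conjI allI impI)
  have f1: "f1 = (\<lambda>_. mu)"
    using assms(2) by blast
  show "fn (f0 y) = f0_fun (fn y)" for y
    by (simp add: f0_eq f0_fun_eq)
  show "C1_map f0"
    by (rule C1_map_diff_poly[OF diff_poly_f0])
  show "C1_map (M n)" for n
    unfolding assms(3) f1 by (rule C1_map_diff_poly[OF diff_poly_ad_f0])
  fix N :: nat assume "N \<ge> 1"
  then obtain n where N: "N = Suc n"
    by (cases N) auto
  show "a_coeff k N (fn mu) = - (1/2) * ip (fn (W N 0)) (phi k)"
  proof -
    have "W N = lie_bracket (M n) (M (Suc n))"
      using assms(4)[of N] N by simp
    then show ?thesis
      using a_coeff_eq_bracket[of k n mu] unfolding N assms(3) f1 by simp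
  qed
qed

end
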